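(* Let $\Gamma$ be a finite simplicial graph that is nontrivial and biconnected. Then, for the action of the right-angled Artin group $A(\Gamma)$ on its extension graph $(\Gamma^e,d_e)$, the minimal asymptotic translation length satisfies $$\mathcal L_{(\Gamma^e,d_e)}(A(\Gamma))\le 2.$$
   Context: Graphs are simplicial (no loops, no multiple edges). For a graph $\Gamma$, $V(\Gamma)$ and $E(\Gamma)$ are the vertex and edge sets, and $\bar\Gamma$ is the complement graph (same vertices; two distinct vertices are adjacent in $\bar\Gamma$ iff they are not adjacent in $\Gamma$). $\Gamma$ is nontrivial if $|V(\Gamma)|\ge 2$, and biconnected if both $\Gamma$ and $\bar\Gamma$ are connected. The right-angled Artin group on a finite simplicial graph $\Gamma$ is $A(\Gamma)=\langle v\in V(\Gamma) : v_iv_j=v_jv_i \text{ if } \{v_i,v_j\}\in E(\Gamma)\rangle$. Write $v^g=g^{-1}vg$. The extension graph $\Gamma^e$ has vertex set $V(\Gamma^e)=\{v^g : v\in V(\Gamma), g\in A(\Gamma)\}\subset A(\Gamma)$, and two distinct vertices $v_1^{g_1},v_2^{g_2}$ are adjacent iff they commute in $A(\Gamma)$. $d_e$ denotes the graph metric on $\Gamma^e$ (length of a shortest path); $\Gamma^e$ is connected when $\Gamma$ is nontrivial and biconnected. $A(\Gamma)$ acts on $\Gamma^e$ from the right by conjugation, $x\cdot g=g^{-1}xg$ for $x\in V(\Gamma^e)$, by isometries. For a group $G$ acting by isometries from the right on a connected metric space $(X,d)$ and $g\in G$, the asymptotic translation length is $\tau_{(X,d)}(g)=\lim_{n\to\infty}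 d(xg^n,x)/n$ for $x\in X$ (the limit exists and is independent of $x$). The minimal asymptotic translation length is $\mathcal L_{(X,d)}(G)=\min\{\tau_{(X,d)}(g): g\in G,\ \tau_{(X,d)}(g)>0\}$. *)

theory Defs
  imports
    Complex_Main
    "HOL-Algebra.Group"
    "Graph_Theory.Graph_Theory"
begin

section \<open>Groups given by generators and relations\<close>

text \<open>
  A word over a set of generators is a list of letters; the letter \<open>(s, False)\<close> stands for
  the generator \<open>s\<close> and \<open>(s, True)\<close> for its formal inverse. A presentation has a set \<open>S\<close> of
  generators and a set \<open>R\<close> of defining equations \<open>r = r'\<close> between words, given as pairs.
\<close>

type_synonym 's word = "('s \<times> bool) list"

definition words_over :: "'s set \<Rightarrow> 's word set" where
  "words_over S = lists (S \<times> UNIV)"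

inductive pres_eq :: "'s set \<Rightarrow> ('s word \<times> 's word) set \<Rightarrow> 's word \<Rightarrow> 's word \<Rightarrow> bool"
  for S :: "'s set" and R :: "('s word \<times> 's word) set" where
  refl: "w \<in> words_over S \<Longrightarrow> pres_eq S R w w"
| sym: "pres_eq S R w w' \<Longrightarrow> pres_eq S R w' w"
| trans: "pres_eq S R w w' \<Longrightarrow> pres_eq S R w' w'' \<Longrightarrow> pres_eq S R w w''"
| cancel: "\<lbrakk>u \<in> words_over S; v \<in> words_over S; s \<in> S\<rbrakk>
    \<Longrightarrow> pres_eq S R (u @ [(s, b), (s, \<not> b)] @ v) (u @ v)"
| rel: "\<lbrakk>u \<in> words_over S; v \<in> words_over S; (r, r') \<in> R; r \<in> words_over S; r' \<in> words_over S\<rbrakk>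
    \<Longrightarrow> pres_eq S R (u @ r @ v) (u @ r' @ v)"

definition pres_class :: "'s set \<Rightarrow> ('s word \<times> 's word) set \<Rightarrow> 's word \<Rightarrow> 's word set" where
  "pres_class S R w = {w'. pres_eq S R w w'}"

definition presented_group :: "'s set \<Rightarrow> ('s word \<times> 's word) set \<Rightarrow> 's word set monoid" where
  "presented_group S R =
     \<lparr>carrier = pres_class S R ` words_over S,
      monoid.mult = (\<lambda>A B. {w. \<exists>a\<in>A. \<exists>b\<in>B. pres_eq S R (a @ b) w}),
      monoid.one = pres_class S R []\<rparr>"

lemma words_over_simps [simp]:
  "[] \<in> words_over S"
  "(x # w) \<in> words_over S \<longleftrightarrow> fst x \<in> S \<and> w \<in> words_over S"
  "(u @ v) \<in> words_over S \<longleftrightarrow> u \<in> words_over S \<and> v \<in> words_over S"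
  by (auto simp: words_over_def mem_Times_iff)

lemma pres_eq_words:
  assumes "pres_eq S R w w'"
  shows "w \<in> words_over S" "w' \<in> words_over S"
  using assms by (induction rule: pres_eq.induct) auto

lemma pres_eq_context:
  assumes "pres_eq S R w w'" "x \<in> words_over S" "y \<in> words_over S"
  shows "pres_eq S R (x @ w @ y) (x @ w' @ y)"
  using assms
proof (induction rule: pres_eq.induct)
  case (refl w)
  then show ?case by (intro pres_eq.refl) simp
next
  case (sym w w')
  then show ?case by (blast intro: pres_eq.sym)
next
  case (trans w w' w'')
  then show ?case by (blast intro: pres_eq.trans)
next
  case (cancel u v s b)
  then show ?case
    using pres_eq.cancel[of "x @ u" S "v @ y" s R b] by simp
next
  case (rel u v r r')
  then show ?case
    using pres_eq.rel[of "x @ u" S "v @ y" r r' R] by simp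
qed

lemma pres_eq_append:
  assumes "pres_eq S R a a'" "pres_eq S R b b'"
  shows "pres_eq S R (a @ b) (a' @ b')"
proof -
  have "pres_eq S R (a @ b) (a' @ b)"
    using pres_eq_context[OF assms(1), of "[]" b] pres_eq_words[OF assms(2)] by simp
  moreover have "pres_eq S R (a' @ b) (a' @ b')"
    using pres_eq_context[OF assms(2), of a' "[]"] pres_eq_words[OF assms(1)] by simp
  ultimately show ?thesis by (rule pres_eq.trans)
qed

lemma pres_class_eq_iff:
  assumes "w \<in> words_over S"
  shows "pres_class S R w = pres_class S R w' \<longleftrightarrow> pres_eq S R w w'"
  using assms unfolding pres_class_def
  by (blast intro: pres_eq.intros)

lemma presented_group_mult:
  assumes "a \<in> words_over S" "b \<in> words_over S"
  shows "pres_class S R a \<otimes>\<^bsub>presented_group S R\<^esub> pres_class S R b = pres_class S R (a @ b)"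
  using assms unfolding presented_group_def pres_class_def
  by (auto intro: pres_eq.trans pres_eq_append pres_eq.refl)

definition inv_word :: "'s word \<Rightarrow> 's word" where
  "inv_word w = rev (map (\<lambda>(s, b). (s, \<not> b)) w)"

lemma inv_word_words [simp]: "w \<in> words_over S \<Longrightarrow> inv_word w \<in> words_over S"
  by (auto simp: inv_word_def words_over_def)

lemma inv_word_left: "w \<in> words_over S \<Longrightarrow> pres_eq S R (inv_word w @ w) []"
proof (induction w)
  case Nil
  then show ?case by (simp add: inv_word_def pres_eq.refl)
next
  case (Cons x w)
  obtain s b where x: "x = (s, b)" by (cases x)
  have "pres_eq S R (inv_word w @ [(s, \<not> b), (s, \<not> \<not> b)] @ w) (inv_word w @ w)"
    using Cons.prems x by (intro pres_eq.cancel) auto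
  then show ?case
    using Cons x by (auto simp: inv_word_def intro: pres_eq.trans)
qed

theorem group_presented_group: "group (presented_group S R)"
proof (rule groupI)
  have one: "\<one>\<^bsub>presented_group S R\<^esub> = pres_class S R []"
    by (simp add: presented_group_def)
  have carrier: "carrier (presented_group S R) = pres_class S R ` words_over S"
    by (simp add: presented_group_def)
  show "\<one>\<^bsub>presented_group S R\<^esub> \<in> carrier (presented_group S R)"
    by (simp add: one carrier)
  show "x \<otimes>\<^bsub>presented_group S R\<^esub> y \<in> carrier (presented_group S R)"
    if "x \<in> carrier (presented_group S R)" "y \<in> carrier (presented_group S R)" for x y
    using that by (auto simp: carrier presented_group_mult)
  show "x \<otimes>\<^bsub>presented_group S R\<^esub> y \<otimes>\<^bsub>presented_group S R\<^esub> z =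
      x \<otimes>\<^bsub>presented_group S R\<^esub> (y \<otimes>\<^bsub>presented_group S R\<^esub> z)"
    if "x \<in> carrier (presented_group S R)" "y \<in> carrier (presented_group S R)"
      "z \<in> carrier (presented_group S R)" for x y z
    using that by (auto simp: carrier presented_group_mult)
  show "\<one>\<^bsub>presented_group S R\<^esub> \<otimes>\<^bsub>presented_group S R\<^esub> x = x"
    if "x \<in> carrier (presented_group S R)" for x
    using that by (auto simp: carrier one presented_group_mult)
  show "\<exists>y\<in>carrier (presented_group S R). y \<otimes>\<^bsub>presented_group S R\<^esub> x = \<one>\<^bsub>presented_group S R\<^esub>"
    if x: "x \<in> carrier (presented_group S R)" for x
  proof -
    obtain w where w: "w \<in> words_over S" "x = pres_class S R w"
      using x by (auto simp: carrier)
    then have "pres_class S R (inv_word w) \<otimes>\<^bsub>presented_group S R\<^esub> x = \<one>\<^bsub>presented_group S R\<^esub>"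
      by (simp add: presented_group_mult one pres_class_eq_iff inv_word_left)
    with w show ?thesis by (auto simp: carrier)
  qed
qed


section \<open>Graphs\<close>

text \<open>
  Finite simplicial graphs are the \<^locale>\<open>pair_graph\<close>s of the library: an undirected edge
  \<open>{u, v}\<close> is the pair of arcs \<open>(u, v)\<close>, \<open>(v, u)\<close>.
\<close>

definition complement_graph :: "'a pair_pre_digraph \<Rightarrow> 'a pair_pre_digraph" where
  "complement_graph G =
     \<lparr>pverts = pverts G,
      parcs = {(u, v). u \<in> pverts G \<and> v \<in> pverts G \<and> u \<noteq> v \<and> (u, v) \<notin> parcs G}\<rparr>"

definition nontrivial_graph :: "'a pair_pre_digraph \<Rightarrow> bool" where
  "nontrivial_graph G \<longleftrightarrow> 2 \<le> card (pverts G)"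

definition biconnected :: "'a pair_pre_digraph \<Rightarrow> bool" where
  "biconnected G \<longleftrightarrow> connected (with_proj G) \<and> connected (with_proj (complement_graph G))"

text \<open>Only meaningful when some walk joins the two vertices.\<close>

definition graph_dist :: "'a pair_pre_digraph \<Rightarrow> 'a \<Rightarrow> 'a \<Rightarrow> real" where
  "graph_dist G u v = real (LEAST n. \<exists>p. pre_digraph.awalk (with_proj G) u p v \<and> length p = n)"


section \<open>Right-angled Artin groups and extension graphs\<close>

definition raag_relations :: "'a pair_pre_digraph \<Rightarrow> ('a word \<times> 'a word) set" where
  "raag_relations G =
     {([(u, False), (v, False)], [(v, False), (u, False)]) | u v. (u, v) \<in> parcs G}"

definition raag :: "'a pair_pre_digraph \<Rightarrow> 'a word set monoid" where
  "raag G = presented_group (pverts G) (raag_relations G)"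

definition raag_gen :: "'a pair_pre_digraph \<Rightarrow> 'a \<Rightarrow> 'a word set" where
  "raag_gen G v = pres_class (pverts G) (raag_relations G) [(v, False)]"

definition conj_act :: "('g, 'b) monoid_scheme \<Rightarrow> 'g \<Rightarrow> 'g \<Rightarrow> 'g" where
  "conj_act A x g = inv\<^bsub>A\<^esub> g \<otimes>\<^bsub>A\<^esub> x \<otimes>\<^bsub>A\<^esub> g"

definition extension_graph :: "'a pair_pre_digraph \<Rightarrow> 'a word set pair_pre_digraph" where
  "extension_graph G =
     (let A = raag G; V = {conj_act A (raag_gen G v) g | v g. v \<in> pverts G \<and> g \<in> carrier A}
      in \<lparr>pverts = V,
          parcs = {(x, y). x \<in> V \<and> y \<in> V \<and> x \<noteq> y \<and> x \<otimes>\<^bsub>A\<^esub> y = y \<otimes>\<^bsub>A\<^esub> x}\<rparr>)"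

lemma group_raag: "group (raag G)"
  unfolding raag_def by (rule group_presented_group)

lemma raag_gen_in_carrier: "v \<in> pverts G \<Longrightarrow> raag_gen G v \<in> carrier (raag G)"
  by (auto simp: raag_def raag_gen_def presented_group_def)

lemma raag_gen_commute:
  assumes "pair_graph G" "(u, v) \<in> parcs G"
  shows "raag_gen G u \<otimes>\<^bsub>raag G\<^esub> raag_gen G v = raag_gen G v \<otimes>\<^bsub>raag G\<^esub> raag_gen G u"
proof -
  interpret pair_graph G by fact
  have uv: "u \<in> pverts G" "v \<in> pverts G"
    using assms(2) by (auto dest: wellformed')
  have "pres_eq (pverts G) (raag_relations G) ([] @ [(u, False), (v, False)] @ []) ([] @ [(v, False), (u, False)] @ [])"
    using uv assms(2) by (intro pres_eq.rel) (auto simp: raag_relations_def)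
  then show ?thesis
    using uv by (simp add: raag_def raag_gen_def presented_group_mult pres_class_eq_iff)
qed

lemma pair_bidirected_digraph_extension_graph: "pair_bidirected_digraph (extension_graph G)"
  by unfold_locales
    (auto simp: extension_graph_def Let_def arcs_ends_def arc_to_ends_def symmetric_def
      with_proj_def intro!: symI)


section \<open>Asymptotic translation lengths\<close>

text \<open>
  For a right action \<open>act\<close> of a group \<open>A\<close> by isometries of a metric space \<open>(X, d)\<close>: the common
  value, over all base points \<open>x\<close>, of the limit of \<open>d (x \<cdot> g\<^sup>n) x / n\<close>.
\<close>

definition asymp_transl_length ::
  "'x set \<Rightarrow> ('x \<Rightarrow> 'x \<Rightarrow> real) \<Rightarrow> ('g, 'b) monoid_scheme \<Rightarrow> ('x \<Rightarrow> 'g \<Rightarrow> 'x) \<Rightarrow> 'g \<Rightarrow> real"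
where
  "asymp_transl_length X d A act g =
     (THE t. \<forall>x\<in>X. (\<lambda>n. d (act x (g [^]\<^bsub>A\<^esub> (n::nat))) x / real n) \<longlonglongrightarrow> t)"

text \<open>
  The infimum is the minimum whenever the latter exists (lemma below). The infimum of the empty
  set of reals is unspecified, so a bound on this quantity says something only together with the
  existence of an element of positive asymptotic translation length.
\<close>

definition min_asymp_transl_length ::
  "'x set \<Rightarrow> ('x \<Rightarrow> 'x \<Rightarrow> real) \<Rightarrow> ('g, 'b) monoid_scheme \<Rightarrow> ('x \<Rightarrow> 'g \<Rightarrow> 'x) \<Rightarrow> real"
where
  "min_asymp_transl_length X d A act =
     Inf {asymp_transl_length X d A act g | g.
            g \<in> carrier A \<and> asymp_transl_length X d A act g > 0}"

lemma min_asymp_transl_length_eqI: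
  assumes "g \<in> carrier A" "asymp_transl_length X d A act g > 0"
    and "\<And>h. \<lbrakk>h \<in> carrier A; asymp_transl_length X d A act h > 0\<rbrakk>
           \<Longrightarrow> asymp_transl_length X d A act g \<le> asymp_transl_length X d A act h"
  shows "min_asymp_transl_length X d A act = asymp_transl_length X d A act g"
  unfolding min_asymp_transl_length_def
  by (rule cInf_eq_minimum) (use assms in auto)

definition ext_transl_length :: "'a pair_pre_digraph \<Rightarrow> 'a word set \<Rightarrow> real" where
  "ext_transl_length G = asymp_transl_length (pverts (extension_graph G))
     (graph_dist (extension_graph G)) (raag G) (conj_act (raag G))"

definition ext_min_transl_length :: "'a pair_pre_digraph \<Rightarrow> real" where
  "ext_min_transl_length G = min_asymp_transl_length (pverts (extension_graph G))
     (graph_dist (extension_graph G)) (raag G) (conj_act (raag G))"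

end

theory Submission
  imports Defs "HOL-Library.Sublist"
begin

text \<open>
  The idea is to find an element \<open>g = h\<^sub>1 h\<^sub>2\<close> such that \<open>h\<^sub>1\<close> and \<open>h\<^sub>2\<close> centralize two adjacent
  generators \<open>a\<close> and \<open>b\<close>. Conjugation by \<open>g\<close> then moves \<open>a\<close> to the same vertex as conjugation by \<open>h\<^sub>2\<close>
  does, and this vertex is adjacent to \<open>b\<close>, because \<open>h\<^sub>2\<close> fixes \<open>b\<close>. As \<open>b\<close> is adjacent to \<open>a\<close>, the element
  \<open>g\<close> moves \<open>a\<close> by at most 2, and its translation length is at most 2.
  The work lies in choosing \<open>a\<close>, \<open>b\<close>, \<open>h\<^sub>1\<close>, \<open>h\<^sub>2\<close> so that the translation length is positive.
  
  Choose the edge \<open>ab\<close> so that the union \<open>U\<close> of the stars of \<open>a\<close> and \<open>b\<close> is as large as possible. Then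
  the complement graph is connected on \<open>U\<close> (\<open>edge_with_indecomposable_stars\<close>). For otherwise \<open>U\<close> splits
  into nonempty parts \<open>X\<close> and \<open>Y\<close> with every vertex of \<open>X\<close> adjacent to every vertex of \<open>Y\<close>; the two
  stars at any edge between \<open>X\<close> and \<open>Y\<close> then cover \<open>U\<close>, so by maximality they stay inside \<open>U\<close>. As the
  graph is connected, \<open>U\<close> is everything, and the complement graph is disconnected, a contradiction. In
  particular \<open>U\<close> lies in no star of a vertex. Let \<open>h\<^sub>1\<close> be the product of the star of \<open>a\<close> and \<open>h\<^sub>2\<close> the
  product of the rest of the star of \<open>b\<close>, so that \<open>g\<close> is a positive word with each letter of \<open>U\<close> once.
  
  For the lower bound, call an element a star element if it is a word in the star of one vertex. A walk
  of length \<open>l\<close> in the extension graph from \<open>a\<close> to \<open>a\<close> conjugated by \<open>x\<close> writes \<open>x\<close> as a product of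
  \<open>2 l + 2\<close> star elements (\<open>walk_star_words\<close>). This uses that the centralizer of a generator is generated by its
  star (\<open>centralizer_gen\<close>) and that a right-angled Artin group retracts onto the subgroup generated by a
  set of vertices. On the other hand a product of \<open>L\<close> star elements equals \<open>g\<^sup>n\<close> only if \<open>n \<le> D L\<close> for a
  constant \<open>D\<close> (\<open>star_length_power_lower_bound\<close>): after cancellation the product is, up to commutations,
  the word \<open>g\<^sup>n\<close>. In every prefix of it the numbers of occurrences of two noncommuting letters of \<open>U\<close> differ by
  at most 1, hence those of any two letters differ by at most a constant, and each star word misses
  some letter of \<open>U\<close>, whose number it leaves unchanged. So \<open>g\<^sup>n\<close> moves \<open>a\<close> at least by a
  linear function of \<open>n\<close>.
  
  Both facts about the group come from one normal form: a reduced word is determined up to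
  commutations by its restrictions to the pairs of noncommuting generators, and the generators act on such families of
  restrictions by appending or deleting last letters (\<open>run_cong\<close>, \<open>reduce_word\<close>).
\<close>

section \<open>Normal forms from restrictions to noncommuting pairs\<close>

abbreviation flip :: "'a \<times> bool \<Rightarrow> 'a \<times> bool" where
  "flip s \<equiv> (fst s, \<not> snd s)"

declare pres_eq.trans [trans]

lemma words_over_iff: "u \<in> words_over S \<longleftrightarrow> (\<forall>s \<in> set u. fst s \<in> S)"
  by (induction u) auto

context pair_graph
begin

abbreviation eqv :: "'a word \<Rightarrow> 'a word \<Rightarrow> bool" (infix "\<approx>" 50) where
  "u \<approx> v \<equiv> pres_eq (pverts G) (raag_relations G) u v"

abbreviation W :: "'a word set" where "W \<equiv> words_over (pverts G)"

lemma adj_sym: "(x, y) \<in> parcs G \<longleftrightarrow> (y, x) \<in> parcs G"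
  using arcs_symmetric by blast

lemma adj_irrefl [simp]: "(x, x) \<notin> parcs G"
  using pair_no_loops by force

text \<open>
  The restrictions of a word to all pairs of equal or noncommuting generators. A word is determined
  by them up to commutations. The value at a commuting pair is a dummy.
\<close>

definition proj :: "'a word \<Rightarrow> 'a \<Rightarrow> 'a \<Rightarrow> 'a word" where
  "proj u = (\<lambda>x y. if (x, y) \<in> parcs G then [] else filter (\<lambda>s. fst s \<in> {x, y}) u)"

definition push :: "'a \<times> bool \<Rightarrow> ('a \<Rightarrow> 'a \<Rightarrow> 'a word) \<Rightarrow> 'a \<Rightarrow> 'a \<Rightarrow> 'a word" where
  "push s P = (\<lambda>x y. if (x, y) \<notin> parcs G \<and> fst s \<in> {x, y} then P x y @ [s] else P x y)"

definition pop :: "'a \<Rightarrow> ('a \<Rightarrow> 'a \<Rightarrow> 'a word) \<Rightarrow> 'a \<Rightarrow> 'a \<Rightarrow> 'a word" where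
  "pop v P = (\<lambda>x y. if (x, y) \<notin> parcs G \<and> v \<in> {x, y} then butlast (P x y) else P x y)"

definition ends_in :: "'a \<times> bool \<Rightarrow> ('a \<Rightarrow> 'a \<Rightarrow> 'a word) \<Rightarrow> bool" where
  "ends_in s P \<longleftrightarrow> (\<forall>x y. (x, y) \<notin> parcs G \<and> fst s \<in> {x, y} \<longrightarrow> P x y \<noteq> [] \<and> last (P x y) = s)"

text \<open>
  Right multiplication of a reduced word by the letter \<open>s\<close>, seen on restrictions: cancel a final
  inverse of \<open>s\<close> if the inverse can be moved to the end of the word, that is, if it is last in every
  restriction that sees the vertex of \<open>s\<close>; otherwise append \<open>s\<close>.
\<close>

definition act :: "'a \<times> bool \<Rightarrow> ('a \<Rightarrow> 'a \<Rightarrow> 'a word) \<Rightarrow> 'a \<Rightarrow> 'a \<Rightarrow> 'a word" where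
  "act s P = (if ends_in (flip s) P then pop (fst s) P else push s P)"

lemma proj_Nil: "proj [] = (\<lambda>_ _. [])"
  by (simp add: proj_def fun_eq_iff)

lemma proj_snoc: "proj (u @ [s]) = push s (proj u)"
  by (auto simp: proj_def push_def fun_eq_iff)

lemma pop_push [simp]: "pop (fst s) (push s P) = P"
  by (auto simp: pop_def push_def fun_eq_iff)

lemma ends_in_push [simp]: "ends_in s (push s P)"
  by (auto simp: ends_in_def push_def)

lemma ends_in_push_dependent:
  assumes "ends_in t (push s P)" "(fst s, fst t) \<notin> parcs G"
  shows "t = s"
proof -
  have dep: "(fst t, fst s) \<notin> parcs G" using assms(2) adj_sym by blast
  then have "last (push s P (fst t) (fst s)) = t"
    using assms(1) unfolding ends_in_def by blast
  then show ?thesis using dep by (simp add: push_def)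
qed

text \<open>
  Letters at adjacent vertices change disjoint sets of restrictions, since a pair that contains both
  vertices is a commuting pair.
\<close>

lemma
  assumes "(fst s, fst t) \<in> parcs G"
  shows push_commute: "push s (push t P) = push t (push s P)"
    and pop_push_commute: "pop (fst s) (push t P) = push t (pop (fst s) P)"
    and pop_pop_commute: "pop (fst s) (pop (fst t) P) = pop (fst t) (pop (fst s) P)"
    and ends_in_push_independent: "ends_in s (push t P) \<longleftrightarrow> ends_in s P"
    and ends_in_pop_independent: "ends_in s (pop (fst t) P) \<longleftrightarrow> ends_in s P"
proof -
  have *: "\<not> (fst s \<in> {x, y} \<and> fst t \<in> {x, y})" if "(x, y) \<notin> parcs G" for x y
    using assms that adj_sym by auto
  show "push s (push t P) = push t (push s P)" 
    using * by (auto simp: push_def fun_eq_iff)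
  show "pop (fst s) (push t P) = push t (pop (fst s) P)"
    using * by (auto simp: push_def pop_def fun_eq_iff)
  show "pop (fst s) (pop (fst t) P) = pop (fst t) (pop (fst s) P)"
    using * by (auto simp: pop_def fun_eq_iff)
  show "ends_in s (push t P) \<longleftrightarrow> ends_in s P"
    using * unfolding push_def ends_in_def
    by (intro all_cong1 imp_cong[OF HOL.refl]) auto
  show "ends_in s (pop (fst t) P) \<longleftrightarrow> ends_in s P"
    using * unfolding pop_def ends_in_def
    by (intro all_cong1 imp_cong[OF HOL.refl]) auto
qed

lemma act_commute:
  assumes "(fst s, fst t) \<in> parcs G"
  shows "act s (act t P) = act t (act s P)"
proof -
  have a: "(fst (flip s), fst t) \<in> parcs G" "(fst (flip t), fst s) \<in> parcs G" "(fst t, fst s) \<in> parcs G"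
    using assms adj_sym by auto
  show ?thesis
    unfolding act_def
    using ends_in_push_independent[OF a(1)] ends_in_push_independent[OF a(2)]
      ends_in_pop_independent[OF a(1)] ends_in_pop_independent[OF a(2)]
      push_commute[OF assms] pop_push_commute[OF assms] pop_push_commute[OF a(3)] pop_pop_commute[OF assms]
    by auto
qed

text \<open>
  The restriction families of reduced words, built letter by letter.
\<close>

inductive valid :: "('a \<Rightarrow> 'a \<Rightarrow> 'a word) \<Rightarrow> bool" where
  valid_empty: "valid (proj [])"
| valid_push: "valid P \<Longrightarrow> \<not> ends_in (flip s) P \<Longrightarrow> valid (push s P)"

text \<open>
  This makes the actions of a letter and its inverse undo each other: deleting a final letter \<open>t\<close> of a
  reduced word leaves a reduced word to which \<open>t\<close> can be appended again without a cancellation. In the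
  induction, a last letter \<open>s\<close> other than \<open>t\<close> must commute with \<open>t\<close>, and then it can be moved past \<open>t\<close>.
\<close>

lemma valid_ends_in:
  assumes "valid P" "ends_in t P"
  shows "\<exists>Q. valid Q \<and> \<not> ends_in (flip t) Q \<and> P = push t Q"
  using assms
proof (induction rule: valid.induct)
  case valid_empty
  then have "proj [] (fst t) (fst t) \<noteq> []"
    unfolding ends_in_def by (metis adj_irrefl insertI1)
  then show ?case by (simp add: proj_Nil)
next
  case (valid_push P s)
  show ?case
  proof (cases "(fst s, fst t) \<in> parcs G")
    case False
    then have "t = s" using ends_in_push_dependent valid_push.prems by blast
    then show ?thesis using valid_push by blast
  next
    case True
    then have st: "(fst t, fst s) \<in> parcs G" "(fst (flip s), fst t) \<in> parcs G"
      "(fst (flip t), fst s) \<in> parcs G" using adj_sym by auto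
    have "ends_in t P" using valid_push.prems ends_in_push_independent[OF st(1)] by blast
    then obtain Q where Q: "valid Q" "\<not> ends_in (flip t) Q" "P = push t Q"
      using valid_push.IH by blast
    have "\<not> ends_in (flip s) Q"
      using valid_push.hyps(2) ends_in_push_independent[OF st(2)] Q(3) by blast
    then have "valid (push s Q)" using Q(1) valid.valid_push by blast
    moreover have "\<not> ends_in (flip t) (push s Q)"
      using Q(2) ends_in_push_independent[OF st(3)] by blast
    moreover have "push s P = push t (push s Q)"
      using push_commute[OF True] Q(3) by simp
    ultimately show ?thesis by blast
  qed
qed

lemma
  assumes "valid P"
  shows valid_act: "valid (act s P)"
    and act_flip: "act (flip s) (act s P) = P"
proof -
  have "valid (act s P) \<and> act (flip s) (act s P) = P"
  proof (cases "ends_in (flip s) P")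
    case False
    then show ?thesis using assms pop_push[of s P] by (auto simp: act_def intro: valid_push)
  next
    case True
    then obtain Q where Q: "valid Q" "\<not> ends_in s Q" "P = push (flip s) Q"
      using valid_ends_in[OF assms True] by auto
    then have "act s P = Q"
      using True pop_push[of "flip s" Q] by (simp add: act_def)
    with Q show ?thesis by (simp add: act_def)
  qed
  then show "valid (act s P)" "act (flip s) (act s P) = P" by auto
qed

definition run :: "'a word \<Rightarrow> ('a \<Rightarrow> 'a \<Rightarrow> 'a word) \<Rightarrow> 'a \<Rightarrow> 'a \<Rightarrow> 'a word" where
  "run u P = fold act u P"

lemma run_simps [simp]:
  "run [] P = P" "run (s # u) P = run u (act s P)" "run (u @ v) P = run v (run u P)"
  by (simp_all add: run_def)

lemma valid_run: "valid P \<Longrightarrow> valid (run u P)"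
  by (induction u arbitrary: P) (auto simp: valid_act)

text \<open>
  The letters act on reduced families compatibly with the defining relations, so the
  resulting family is an invariant of the group element.
\<close>

lemma run_cong:
  assumes "u \<approx> u'" "valid P"
  shows "run u P = run u' P"
  using assms
proof (induction arbitrary: P rule: pres_eq.induct)
  case (cancel u v s b)
  have "valid (run u P)" using cancel valid_run by blast
  then show ?case using act_flip[of "run u P" "(s, b)"] by simp
next
  case (rel u v r r')
  then obtain x y where "r = [(x, False), (y, False)]" "r' = [(y, False), (x, False)]" 
    "(x, y) \<in> parcs G" by (auto simp: raag_relations_def)
  then show ?case using act_commute[of "(x, False)" "(y, False)"] by simp
qed auto

lemma flip_commute:
  assumes "[s, t] \<approx> [t, s]"
  shows "[flip s, t] \<approx> [t, flip s]"
proof -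
  obtain x b where s: "s = (x, b)" by (cases s)
  have st: "fst s \<in> pverts G" "fst t \<in> pverts G"
    using pres_eq_words[OF assms] by auto
  have "[flip s, t] \<approx> [flip s, t, s, flip s]"
    using pres_eq.sym[OF pres_eq.cancel[of "[flip s, t]" "pverts G" "[]" x "raag_relations G" b]] st s by auto
  also have "[flip s, t, s, flip s] \<approx> [flip s, s, t, flip s]"
    using pres_eq_context[OF pres_eq.sym[OF assms], of "[flip s]" "[flip s]"] st by simp
  also have "[flip s, s, t, flip s] \<approx> [t, flip s]"
    using pres_eq.cancel[of "[]" "pverts G" "[t, flip s]" x "raag_relations G" "\<not> b"] st s by auto
  finally show ?thesis .
qed

lemma letters_commute:
  assumes "(fst s, fst t) \<in> parcs G"
  shows "[s, t] \<approx> [t, s]"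
proof -
  obtain x b y c where st: "s = (x, b)" "t = (y, c)" by (metis prod.exhaust)
  have v: "x \<in> pverts G" "y \<in> pverts G" using assms wellformed' st by auto
  have 1: "[(x, False), (y, False)] \<approx> [(y, False), (x, False)]"
    using pres_eq.rel[of "[]" "pverts G" "[]" "[(x, False), (y, False)]" "[(y, False), (x, False)]"
      "raag_relations G"] assms v st
    by (auto simp: raag_relations_def)
  have 2: "[(x, b), (y, False)] \<approx> [(y, False), (x, b)]"
    using 1 flip_commute[OF 1] by (cases b) auto
  then have "[(x, b), (y, c)] \<approx> [(y, c), (x, b)]"
    using flip_commute[OF pres_eq.sym[OF 2]] by (cases c) (auto intro: pres_eq.sym)
  then show ?thesis using st by simp
qed

lemma letter_word_commute:
  assumes "\<And>r. r \<in> set u \<Longrightarrow> (fst s, fst r) \<in> parcs G" "fst s \<in> pverts G"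
  shows "s # u \<approx> u @ [s]"
  using assms
proof (induction u)
  case Nil
  then show ?case by (auto intro: pres_eq.refl)
next
  case (Cons r u)
  have "fst q \<in> pverts G" if "q \<in> set (r # u)" for q
    using Cons.prems(1)[OF that] wellformed' by blast
  then have u: "u \<in> W" "fst r \<in> pverts G"
    by (auto simp: words_over_iff)
  have "s # r # u \<approx> r # s # u"
    using pres_eq_context[OF letters_commute[of s r], of "[]" u] Cons.prems u by auto
  also have "r # s # u \<approx> r # u @ [s]"
    using pres_eq_context[OF Cons.IH, of "[r]" "[]"] Cons.prems u by auto
  finally show ?case by simp
qed

lemma ends_in_proj_split:
  assumes "ends_in t (proj u)"
  shows "\<exists>u1 u2. u = u1 @ t # u2 \<and> (\<forall>r \<in> set u2. (fst t, fst r) \<in> parcs G)"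
  using assms
proof (induction u rule: rev_induct)
  case Nil
  then have "proj [] (fst t) (fst t) \<noteq> []"
    unfolding ends_in_def by (metis adj_irrefl insertI1)
  then show ?case by (simp add: proj_Nil)
next
  case (snoc r u)
  show ?case
  proof (cases "(fst r, fst t) \<in> parcs G")
    case False
    then have "t = r" using snoc.prems ends_in_push_dependent by (auto simp: proj_snoc)
    then show ?thesis by (intro exI[of _ u] exI[of _ "[]"]) simp
  next
    case True
    then have "ends_in t (proj u)"
      using snoc.prems ends_in_push_independent[of t r] adj_sym by (auto simp: proj_snoc)
    then obtain u1 u2 where "u = u1 @ t # u2" "\<forall>r \<in> set u2. (fst t, fst r) \<in> parcs G"
      using snoc.IH by blast
    then show ?thesis using True adj_sym by (intro exI[of _ u1] exI[of _ "u2 @ [r]"]) auto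
  qed
qed

lemma proj_commute:
  assumes "\<forall>r \<in> set u2. (fst t, fst r) \<in> parcs G"
  shows "proj (u1 @ t # u2) = push t (proj (u1 @ u2))"
  using assms
proof (induction u2 rule: rev_induct)
  case Nil
  then show ?case by (simp add: proj_snoc)
next
  case (snoc r u2)
  then show ?case
    using proj_snoc[of "u1 @ t # u2" r] proj_snoc[of "u1 @ u2" r] push_commute[of t r] by simp
qed

text \<open>
  Reduction only deletes letters, in cancelling pairs, and its result is read off from the
  invariant \<open>run\<close>. Being a subsequence is what later lets reduction respect a factorization into star
  words; the parity serves to exclude that exactly one letter disappears.
\<close>

lemma reduce_word:
  assumes "u \<in> W"
  obtains u' where "subseq u' u" "u' \<approx> u" "even (length u + length u')" "run u (proj []) = proj u'"
proof -
  have "\<exists>u'. subseq u' u \<and> u' \<approx> u \<and> even (length u + length u') \<and> run u (proj []) = proj u'"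
    using assms
  proof (induction u rule: rev_induct)
    case Nil
    then show ?case by (intro exI[of _ "[]"]) (auto intro: pres_eq.refl)
  next
    case (snoc s u)
    then obtain u' where u': "subseq u' u" "u' \<approx> u" "even (length u + length u')"
      "run u (proj []) = proj u'" by auto
    have s: "fst s \<in> pverts G" using snoc.prems by simp
    have eq: "u' @ [s] \<approx> u @ [s]"
      using pres_eq_context[OF u'(2), of "[]" "[s]"] s by simp
    show ?case
    proof (cases "ends_in (flip s) (proj u')")
      case False
      then have "run (u @ [s]) (proj []) = proj (u' @ [s])"
        using u'(4) by (simp add: act_def proj_snoc)
      moreover have "subseq (u' @ [s]) (u @ [s])" using u'(1) by simp
      ultimately show ?thesis using eq u'(3) by (intro exI[of _ "u' @ [s]"]) auto
    next
      case True
      then obtain u1 u2 where split: "u' = u1 @ flip s # u2"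
        and ind: "\<forall>r \<in> set u2. (fst s, fst r) \<in> parcs G"
        using ends_in_proj_split[OF True] by auto
      have u12: "u1 \<in> W" "u2 \<in> W" using pres_eq_words[OF u'(2)] split by auto
      have "run (u @ [s]) (proj []) = pop (fst s) (push (flip s) (proj (u1 @ u2)))"
        using u'(4) True split ind proj_commute[of u2 "flip s" u1] by (simp add: act_def)
      also have "\<dots> = proj (u1 @ u2)" using pop_push[of "flip s"] by simp
      finally have run: "run (u @ [s]) (proj []) = proj (u1 @ u2)" .
      have "u1 @ u2 \<approx> u1 @ [flip s, s] @ u2"
        using pres_eq.sym[OF pres_eq.cancel[of u1 "pverts G" u2 "fst s" "raag_relations G" "\<not> snd s"]] u12 s
        by simp
      also have "u1 @ [flip s, s] @ u2 \<approx> u1 @ flip s # (u2 @ [s])"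
        using pres_eq_context[OF letter_word_commute[of u2 s], of "u1 @ [flip s]" "[]"] ind s u12 by auto
      also have "u1 @ flip s # (u2 @ [s]) \<approx> u @ [s]" using eq split by simp
      finally have "u1 @ u2 \<approx> u @ [s]" .
      moreover have "subseq (u1 @ u2) (u @ [s])"
      proof -
        have "subseq (u1 @ u2) (u1 @ flip s # u2)"
          by (intro list_emb_append_mono) auto
        then have "subseq (u1 @ u2) u" using u'(1) split subseq_order.trans by blast
        then show ?thesis by (rule subseq_rev_drop_many)
      qed
      moreover have "even (length (u @ [s]) + length (u1 @ u2))" using u'(3) split by auto
      ultimately show ?thesis using run by blast
    qed
  qed
  then show ?thesis using that by blast
qed

text \<open>
  A positive word is reduced, since nothing in it can cancel.
\<close>

lemma run_positive:
  assumes "\<forall>s \<in> set u. \<not> snd s"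
  shows "run u (proj []) = proj u"
  using assms
proof (induction u rule: rev_induct)
  case (snoc s u)
  have "\<not> ends_in (flip s) (proj u)"
  proof
    assume "ends_in (flip s) (proj u)"
    then obtain u1 u2 where "u = u1 @ flip s # u2" using ends_in_proj_split by blast
    then show False using snoc.prems by auto
  qed
  then show ?case using snoc by (simp add: act_def proj_snoc)
qed simp

end

section \<open>Centralizers of generators\<close>

lemma Cons_eq_snoc_imp_set: "x # l = l @ [x] \<Longrightarrow> set l \<subseteq> {x}"
  by (induction l) auto

context pair_graph
begin

abbreviation A :: "'a word set monoid" where "A \<equiv> raag G"

abbreviation cls :: "'a word \<Rightarrow> 'a word set" where
  "cls u \<equiv> pres_class (pverts G) (raag_relations G) u"

abbreviation gen :: "'a \<Rightarrow> 'a word set" where "gen v \<equiv> raag_gen G v"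

sublocale A: group A by (rule group_raag)

lemma carrier_A: "carrier A = cls ` W"
  by (simp add: raag_def presented_group_def)

lemma one_A: "\<one>\<^bsub>A\<^esub> = cls []"
  by (simp add: raag_def presented_group_def)

lemma cls_mult: "u \<in> W \<Longrightarrow> v \<in> W \<Longrightarrow> cls u \<otimes>\<^bsub>A\<^esub> cls v = cls (u @ v)"
  by (simp add: raag_def presented_group_mult)

lemma cls_eq_iff: "u \<in> W \<Longrightarrow> cls u = cls v \<longleftrightarrow> u \<approx> v"
  by (rule pres_class_eq_iff)

lemma cls_carrier [simp, intro]: "u \<in> W \<Longrightarrow> cls u \<in> carrier A"
  by (simp add: carrier_A)

lemma cls_inv: "u \<in> W \<Longrightarrow> inv\<^bsub>A\<^esub> (cls u) = cls (inv_word u)"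
  by (intro A.inv_equality) (auto simp: cls_mult one_A cls_eq_iff inv_word_left)

lemma gen_carrier [simp, intro]: "v \<in> pverts G \<Longrightarrow> gen v \<in> carrier A"
  by (rule raag_gen_in_carrier)

definition parabolic :: "'a set \<Rightarrow> 'a word set set" where
  "parabolic X = cls ` words_over X"

lemma words_over_mono: "X \<subseteq> Y \<Longrightarrow> u \<in> words_over X \<Longrightarrow> u \<in> words_over Y"
  by (auto simp: words_over_iff)

lemma parabolic_carrier: "X \<subseteq> pverts G \<Longrightarrow> x \<in> parabolic X \<Longrightarrow> x \<in> carrier A"
  by (auto simp: parabolic_def intro: words_over_mono)

lemma subgroup_parabolic:
  assumes "X \<subseteq> pverts G"
  shows "subgroup (parabolic X) A"
proof (rule A.subgroupI)
  show "parabolic X \<subseteq> carrier A" using parabolic_carrier[OF assms] by auto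
  show "parabolic X \<noteq> {}" unfolding parabolic_def using words_over_simps(1) by blast
  fix a assume "a \<in> parabolic X"
  then obtain u where u: "u \<in> words_over X" "a = cls u" by (auto simp: parabolic_def)
  have uW: "u \<in> W" using words_over_mono[OF assms u(1)] .
  show "inv\<^bsub>A\<^esub> a \<in> parabolic X"
    using u uW unfolding parabolic_def by (simp add: cls_inv)
  fix b assume "b \<in> parabolic X"
  then obtain v where v: "v \<in> words_over X" "b = cls v" by (auto simp: parabolic_def)
  have "v \<in> W" using words_over_mono[OF assms v(1)] .
  then have "a \<otimes>\<^bsub>A\<^esub> b = cls (u @ v)" using u v uW cls_mult by simp
  then show "a \<otimes>\<^bsub>A\<^esub> b \<in> parabolic X"
    using u v unfolding parabolic_def by simp
qed

lemma gen_parabolic: "v \<in> X \<Longrightarrow> gen v \<in> parabolic X"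
  by (auto simp: parabolic_def raag_gen_def)

definition star :: "'a \<Rightarrow> 'a set" where
  "star v = {x. x = v \<or> (v, x) \<in> parcs G}"

lemma star_verts: "v \<in> pverts G \<Longrightarrow> star v \<subseteq> pverts G"
  using wellformed' by (auto simp: star_def)

lemma parabolic_star_commute:
  assumes "v \<in> pverts G" "x \<in> parabolic (star v)"
  shows "gen v \<otimes>\<^bsub>A\<^esub> x = x \<otimes>\<^bsub>A\<^esub> gen v"
proof -
  have letter: "(v, False) # [s] \<approx> [s] @ [(v, False)]" if "fst s \<in> star v" for s
  proof (cases "fst s = v")
    case False
    then show ?thesis using that letters_commute[of "(v, False)" s] by (simp add: star_def)
  next
    case True
    then consider "s = (v, False)" | "s = (v, True)" by (metis (full_types) prod.collapse)
    then show ?thesis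
    proof cases
      case 1
      then show ?thesis using assms(1) by (auto intro: pres_eq.refl)
    next
      case 2
      have "[(v, False), (v, True)] \<approx> []" "[(v, True), (v, False)] \<approx> []"
        using pres_eq.cancel[of "[]" "pverts G" "[]" v "raag_relations G" False]
          pres_eq.cancel[of "[]" "pverts G" "[]" v "raag_relations G" True] assms(1) by auto
      then show ?thesis using 2 by (auto intro: pres_eq.sym pres_eq.trans)
    qed
  qed
  have "(v, False) # u \<approx> u @ [(v, False)]" if "u \<in> words_over (star v)" for u
    using that
  proof (induction u)
    case Nil
    then show ?case using assms(1) by (auto intro: pres_eq.refl)
  next
    case (Cons s u)
    have u: "u \<in> W" "fst s \<in> pverts G"
      using Cons.prems star_verts[OF assms(1)] words_over_mono by auto
    have "(v, False) # s # u \<approx> s # (v, False) # u"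
      using pres_eq_context[OF letter[of s], of "[]" u] Cons.prems u by auto
    also have "s # (v, False) # u \<approx> s # u @ [(v, False)]"
      using pres_eq_context[OF Cons.IH, of "[s]" "[]"] Cons.prems u by auto
    finally show ?case by simp
  qed
  note comm = this
  obtain u where u: "u \<in> words_over (star v)" "x = cls u"
    using assms(2) by (auto simp: parabolic_def)
  have uW: "u \<in> W" using words_over_mono[OF star_verts[OF assms(1)] u(1)] .
  then have "cls ((v, False) # u) = cls (u @ [(v, False)])"
    using comm[OF u(1)] cls_eq_iff[of "(v, False) # u"] assms(1) by simp
  then show ?thesis
    using u uW assms(1) cls_mult[of "[(v, False)]" u] cls_mult[of u "[(v, False)]"]
    by (simp add: raag_gen_def)
qed

text \<open>
  By parity, a word that could be shortened could be shortened by two letters; so a word within one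
  letter of the shortest possible length is reduced.
\<close>

lemma run_minimal:
  assumes "u \<in> W" "\<And>u'. u' \<approx> u \<Longrightarrow> length u \<le> Suc (length u')"
  shows "run u (proj []) = proj u"
proof -
  obtain u' where u': "subseq u' u" "u' \<approx> u" "even (length u + length u')"
    "run u (proj []) = proj u'"
    using reduce_word[OF assms(1)] by blast
  have "length u' \<le> length u" using u'(1) list_emb_length by blast
  moreover have "length u \<le> Suc (length u')" using assms(2) u'(2) by blast
  ultimately have "length u' = length u" using u'(3)
    by (metis le_SucE le_antisym even_Suc even_add add_Suc_right add_Suc odd_add)
  then show ?thesis using u'(1,4) subseq_same_length by blast
qed

text \<open>
  Write \<open>x = c u\<close> with \<open>c\<close> in the subgroup generated by the star of \<open>v\<close> and \<open>u\<close> a shortest possible word.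
  Then \<open>u\<close> commutes with \<open>v\<close>, and both \<open>v u\<close> and \<open>u v\<close> are reduced, since deleting two letters would
  produce a shorter \<open>u\<close>. Hence \<open>v u\<close> and \<open>u v\<close> have the same restrictions. At a vertex that does not
  commute with \<open>v\<close> this forces the restriction of \<open>u\<close> to be a power of \<open>v\<close>, so \<open>u\<close> is a word in the star.
\<close>

lemma centralizer_gen:
  assumes v: "v \<in> pverts G" and x: "x \<in> carrier A" and comm: "x \<otimes>\<^bsub>A\<^esub> gen v = gen v \<otimes>\<^bsub>A\<^esub> x"
  shows "x \<in> parabolic (star v)"
proof -
  define S where "S = parabolic (star v)"
  interpret S: subgroup S A unfolding S_def by (rule subgroup_parabolic[OF star_verts[OF v]])
  define P where "P u \<longleftrightarrow> u \<in> W \<and> (\<exists>c \<in> S. x = c \<otimes>\<^bsub>A\<^esub> cls u)" for u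
  obtain ux where "ux \<in> W" "x = cls ux" using x by (auto simp: carrier_A)
  then have "P ux" unfolding P_def using x by (auto intro!: bexI[of _ "\<one>\<^bsub>A\<^esub>"])
  then obtain u where Pu: "P u" and least: "\<And>u'. P u' \<Longrightarrow> length u \<le> length u'"
    using ex_has_least_nat[of P ux length] by blast
  then obtain c where u: "u \<in> W" and c: "c \<in> S" "x = c \<otimes>\<^bsub>A\<^esub> cls u" by (auto simp: P_def)
  have g: "gen v \<in> S" by (simp add: S_def gen_parabolic star_def)
  let ?s = "(v, False)"
  have gc: "gen v \<otimes>\<^bsub>A\<^esub> c = c \<otimes>\<^bsub>A\<^esub> gen v"
    using parabolic_star_commute[OF v] c by (simp add: S_def)
  have "c \<otimes>\<^bsub>A\<^esub> (cls u \<otimes>\<^bsub>A\<^esub> gen v) = x \<otimes>\<^bsub>A\<^esub> gen v"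
    using c u v by (simp add: A.m_assoc)
  also have "\<dots> = (gen v \<otimes>\<^bsub>A\<^esub> c) \<otimes>\<^bsub>A\<^esub> cls u"
    using c u v comm by (simp add: A.m_assoc)
  also have "\<dots> = c \<otimes>\<^bsub>A\<^esub> (gen v \<otimes>\<^bsub>A\<^esub> cls u)"
    using c u v gc by (simp add: A.m_assoc)
  finally have uv: "cls u \<otimes>\<^bsub>A\<^esub> gen v = gen v \<otimes>\<^bsub>A\<^esub> cls u"
    using c u v by simp
  \<comment> \<open>Words for \<open>v u\<close> compete with \<open>u\<close> too, since \<open>v\<close> can be absorbed into \<open>c\<close>.\<close>
  have P: "P u'" if "u' \<in> W" "cls u' = gen v \<otimes>\<^bsub>A\<^esub> cls u" for u'
  proof -
    have "x = (c \<otimes>\<^bsub>A\<^esub> inv\<^bsub>A\<^esub> (gen v)) \<otimes>\<^bsub>A\<^esub> (gen v \<otimes>\<^bsub>A\<^esub> cls u)"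
      using c(2) u v S.mem_carrier[OF c(1)]
      by (metis A.inv_closed A.l_inv A.m_assoc A.m_closed A.r_one cls_carrier gen_carrier)
    moreover have "c \<otimes>\<^bsub>A\<^esub> inv\<^bsub>A\<^esub> (gen v) \<in> S" using c g by simp
    ultimately show ?thesis unfolding P_def using that by metis
  qed
  have gu: "gen v \<otimes>\<^bsub>A\<^esub> cls u = cls (?s # u)" "cls u \<otimes>\<^bsub>A\<^esub> gen v = cls (u @ [?s])"
    using u v by (simp_all add: raag_gen_def cls_mult)
  have W: "?s # u \<in> W" "u @ [?s] \<in> W" using u v by auto
  have 1: "run (?s # u) (proj []) = proj (?s # u)"
  proof (rule run_minimal[OF W(1)])
    fix u' assume "u' \<approx> ?s # u"
    then have "P u'" using P[of u'] gu pres_eq_words cls_eq_iff by metis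
    then show "length (?s # u) \<le> Suc (length u')" using least by simp
  qed
  have 2: "run (u @ [?s]) (proj []) = proj (u @ [?s])"
  proof (rule run_minimal[OF W(2)])
    fix u' assume "u' \<approx> u @ [?s]"
    then have "P u'" using P[of u'] gu uv pres_eq_words cls_eq_iff by metis
    then show "length (u @ [?s]) \<le> Suc (length u')" using least by simp
  qed
  have "?s # u \<approx> u @ [?s]" using gu uv W cls_eq_iff by metis
  then have "run (?s # u) (proj []) = run (u @ [?s]) (proj [])"
    using run_cong valid_empty by blast
  with 1 2 have eq: "proj (?s # u) = proj (u @ [?s])" by metis
  have "fst r \<in> star v" if r: "r \<in> set u" for r
  proof (rule ccontr)
    assume "fst r \<notin> star v"
    then have nadj: "(v, fst r) \<notin> parcs G" "fst r \<noteq> v" by (auto simp: star_def)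
    let ?f = "filter (\<lambda>s. fst s \<in> {v, fst r}) u"
    have "proj (?s # u) v (fst r) = ?s # ?f" "proj (u @ [?s]) v (fst r) = ?f @ [?s]"
      using nadj by (auto simp: proj_def)
    then have "?s # ?f = ?f @ [?s]" using eq by metis
    from Cons_eq_snoc_imp_set[OF this] have "r = ?s" using r by auto
    then show False using nadj by auto
  qed
  then have "cls u \<in> S" by (auto simp: S_def parabolic_def words_over_iff)
  then show ?thesis using c S.m_closed by (simp add: S_def)
qed

lemma gen_neq_one: "gen v \<noteq> \<one>\<^bsub>A\<^esub>" if "v \<in> pverts G"
proof
  assume "gen v = \<one>\<^bsub>A\<^esub>"
  then have "cls [(v, False)] = cls []" unfolding raag_gen_def one_A .
  then have "[(v, False)] \<approx> []" using that cls_eq_iff[of "[(v, False)]"] by simp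
  from run_cong[OF this valid_empty] have "run [(v, False)] (proj []) = run [] (proj [])" .
  moreover have "run [(v, False)] (proj []) = proj [(v, False)]" by (rule run_positive) simp
  ultimately have "proj [(v, False)] v v = proj [] v v" by simp
  then show False by (simp add: proj_def)
qed

text \<open>
  Killing the generators outside of \<open>X\<close> respects the defining relations. This gives the retraction of
  the group onto the subgroup generated by \<open>X\<close>.
\<close>

lemma filter_cong_words:
  assumes "u \<approx> u'"
  shows "filter (\<lambda>s. fst s \<in> X) u \<approx> filter (\<lambda>s. fst s \<in> X) u'"
  using assms
proof (induction rule: pres_eq.induct)
  case (refl w)
  then show ?case by (intro pres_eq.refl) (auto simp: words_over_iff)
next
  case (sym w w')
  then show ?case by (blast intro: pres_eq.sym)
next
  case (trans w w' w'')
  then show ?case by (blast intro: pres_eq.trans)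
next
  case (cancel u v s b)
  then have W: "filter (\<lambda>s. fst s \<in> X) u \<in> W" "filter (\<lambda>s. fst s \<in> X) v \<in> W"
    by (auto simp: words_over_iff)
  show ?case
  proof (cases "s \<in> X")
    case True
    then show ?thesis using pres_eq.cancel[OF W cancel(3), of _ b] by simp
  next
    case False
    then show ?thesis using W pres_eq.refl[of _ "pverts G"] by simp
  qed
next
  case (rel u v r r')
  let ?f = "filter (\<lambda>s. fst s \<in> X)"
  have uv: "?f u \<in> W" "?f v \<in> W" using rel by (auto simp: words_over_iff)
  obtain x y where r: "r = [(x, False), (y, False)]" "r' = [(y, False), (x, False)]"
    using rel(3) by (auto simp: raag_relations_def)
  have xy: "x \<in> pverts G" "y \<in> pverts G" using r rel(4) by auto
  have "?f r \<approx> ?f r'"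
  proof (cases "x \<in> X \<and> y \<in> X")
    case True
    then have "?f r = r" "?f r' = r'" using r by auto
    then show ?thesis using pres_eq.rel[of "[]" "pverts G" "[]" r r'] rel by simp
  next
    case False
    then have "?f r = ?f r'" "?f r \<in> W" using r xy by auto
    then show ?thesis using pres_eq.refl by metis
  qed
  then show ?case using pres_eq_context[OF _ uv] by simp
qed

definition retraction :: "'a set \<Rightarrow> 'a word set \<Rightarrow> 'a word set" where
  "retraction X x = cls (filter (\<lambda>s. fst s \<in> X) (SOME u. u \<in> W \<and> cls u = x))"

lemma retraction_cls:
  assumes "u \<in> W"
  shows "retraction X (cls u) = cls (filter (\<lambda>s. fst s \<in> X) u)"
proof -
  define u' where "u' = (SOME u'. u' \<in> W \<and> cls u' = cls u)"
  have "u' \<in> W \<and> cls u' = cls u" unfolding u'_def by (rule someI[of _ u]) (use assms in simp)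
  then have "u' \<approx> u" using cls_eq_iff by blast
  from filter_cong_words[OF this] have "cls (filter (\<lambda>s. fst s \<in> X) u') = cls (filter (\<lambda>s. fst s \<in> X) u)"
    using cls_eq_iff pres_eq_words by blast
  then show ?thesis by (simp add: retraction_def u'_def)
qed

lemma retraction_mult:
  assumes "x \<in> carrier A" "y \<in> carrier A"
  shows "retraction X (x \<otimes>\<^bsub>A\<^esub> y) = retraction X x \<otimes>\<^bsub>A\<^esub> retraction X y"
proof -
  obtain u v where uv: "u \<in> W" "v \<in> W" "x = cls u" "y = cls v" using assms by (auto simp: carrier_A)
  then have "filter (\<lambda>s. fst s \<in> X) u \<in> W" "filter (\<lambda>s. fst s \<in> X) v \<in> W"
    by (auto simp: words_over_iff)
  then show ?thesis using uv by (simp add: retraction_cls cls_mult)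
qed

lemma retraction_parabolic: "x \<in> carrier A \<Longrightarrow> retraction X x \<in> parabolic X"
  by (auto simp: carrier_A retraction_cls) (auto simp: parabolic_def words_over_iff)

lemma retraction_fixes:
  assumes "X \<subseteq> pverts G" "x \<in> parabolic X"
  shows "retraction X x = x"
proof -
  obtain u where u: "u \<in> words_over X" "x = cls u" using assms by (auto simp: parabolic_def)
  then have "filter (\<lambda>s. fst s \<in> X) u = u" by (auto simp: words_over_iff filter_id_conv)
  then show ?thesis using u words_over_mono[OF assms(1)] by (simp add: retraction_cls)
qed

lemma retraction_gen_outside:
  assumes "v \<in> pverts G" "v \<notin> X"
  shows "retraction X (gen v) = \<one>\<^bsub>A\<^esub>"
  using assms retraction_cls[of "[(v, False)]"] by (simp add: raag_gen_def one_A)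

text \<open>
  Since \<open>q\<close> fixes \<open>v\<close> and \<open>p\<close> fixes \<open>w\<close>, both vertices arise from generators by the same conjugator
  \<open>q h\<close>. Put \<open>x = k h\<^bsup>-1\<^esup>\<close>. Then \<open>z = x v x\<^bsup>-1\<^esup>\<close> centralizes \<open>w\<close>, so it
  lies in the subgroup of the star of \<open>w\<close> and is fixed by the retraction to it. If \<open>y\<close> is the image of
  \<open>x\<close> under this retraction, then also \<open>z = y v y\<^bsup>-1\<^esup>\<close>, so \<open>y\<^bsup>-1\<^esup> x\<close> centralizes \<open>v\<close>.
\<close>

lemma commuting_conjugates:
  assumes v: "v \<in> pverts G" and w: "w \<in> pverts G" and h: "h \<in> carrier A" and k: "k \<in> carrier A"
    and comm: "conj_act A (gen v) h \<otimes>\<^bsub>A\<^esub> conj_act A (gen w) k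
      = conj_act A (gen w) k \<otimes>\<^bsub>A\<^esub> conj_act A (gen v) h"
  shows "\<exists>p \<in> parabolic (star w). \<exists>q \<in> parabolic (star v). k = p \<otimes>\<^bsub>A\<^esub> (q \<otimes>\<^bsub>A\<^esub> h)"
proof -
  define x where "x = k \<otimes>\<^bsub>A\<^esub> inv\<^bsub>A\<^esub> h"
  define z where "z = x \<otimes>\<^bsub>A\<^esub> gen v \<otimes>\<^bsub>A\<^esub> inv\<^bsub>A\<^esub> x"
  have x: "x \<in> carrier A" using h k by (simp add: x_def)
  have z: "z \<in> carrier A" using x v by (simp add: z_def)
  have zx: "z \<otimes>\<^bsub>A\<^esub> x = x \<otimes>\<^bsub>A\<^esub> gen v" using x v by (simp add: z_def A.m_assoc)
  have kx: "inv\<^bsub>A\<^esub> x = h \<otimes>\<^bsub>A\<^esub> inv\<^bsub>A\<^esub> k" using h k by (simp add: x_def A.inv_mult_group)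
  have z': "z = k \<otimes>\<^bsub>A\<^esub> conj_act A (gen v) h \<otimes>\<^bsub>A\<^esub> inv\<^bsub>A\<^esub> k"
    using h k v unfolding z_def kx unfolding x_def conj_act_def by (simp add: A.m_assoc)
  have w': "gen w = k \<otimes>\<^bsub>A\<^esub> conj_act A (gen w) k \<otimes>\<^bsub>A\<^esub> inv\<^bsub>A\<^esub> k"
    using k w unfolding conj_act_def
    by (simp add: A.m_assoc) (simp add: A.m_assoc[symmetric])
  define a b where "a = conj_act A (gen v) h" and "b = conj_act A (gen w) k"
  have ab: "a \<in> carrier A" "b \<in> carrier A" "a \<otimes>\<^bsub>A\<^esub> b = b \<otimes>\<^bsub>A\<^esub> a"
    using h k v w comm by (simp_all add: a_def b_def conj_act_def)
  have conj_mult: "(k \<otimes>\<^bsub>A\<^esub> c \<otimes>\<^bsub>A\<^esub> inv\<^bsub>A\<^esub> k) \<otimes>\<^bsub>A\<^esub> (k \<otimes>\<^bsub>A\<^esub> d \<otimes>\<^bsub>A\<^esub> inv\<^bsub>A\<^esub> k)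
      = k \<otimes>\<^bsub>A\<^esub> (c \<otimes>\<^bsub>A\<^esub> d) \<otimes>\<^bsub>A\<^esub> inv\<^bsub>A\<^esub> k" if "c \<in> carrier A" "d \<in> carrier A" for c d
  proof -
    have "inv\<^bsub>A\<^esub> k \<otimes>\<^bsub>A\<^esub> (k \<otimes>\<^bsub>A\<^esub> (d \<otimes>\<^bsub>A\<^esub> inv\<^bsub>A\<^esub> k)) = d \<otimes>\<^bsub>A\<^esub> inv\<^bsub>A\<^esub> k"
      using that k by (simp add: A.m_assoc[symmetric])
    then show ?thesis using that k by (simp add: A.m_assoc)
  qed
  have "z \<otimes>\<^bsub>A\<^esub> gen w = gen w \<otimes>\<^bsub>A\<^esub> z"
    using conj_mult[OF ab(1,2)] conj_mult[OF ab(2,1)] ab(3) z' w' by (simp add: a_def b_def)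
  then have "z \<in> parabolic (star w)" using centralizer_gen[OF w z] by blast
  then have rz: "retraction (star w) z = z" using retraction_fixes star_verts[OF w] by blast
  define y where "y = retraction (star w) x"
  have yp: "y \<in> parabolic (star w)" unfolding y_def by (rule retraction_parabolic[OF x])
  then have y: "y \<in> carrier A" using parabolic_carrier star_verts[OF w] by blast
  have zy: "z \<otimes>\<^bsub>A\<^esub> y = y \<otimes>\<^bsub>A\<^esub> retraction (star w) (gen v)"
    using arg_cong[OF zx, of "retraction (star w)"] x z v rz by (simp add: retraction_mult y_def)
  have "v \<in> star w"
  proof (rule ccontr)
    assume "v \<notin> star w"
    then have "z \<otimes>\<^bsub>A\<^esub> y = y" using zy y v retraction_gen_outside by simp
    then have "z = \<one>\<^bsub>A\<^esub>" using y z A.l_cancel_one' A.r_cancel_one by metis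
    then have "gen v = \<one>\<^bsub>A\<^esub>" using zx x v by (metis A.l_one A.l_cancel_one gen_carrier A.r_cancel_one')
    then show False using gen_neq_one v by blast
  qed
  then have "retraction (star w) (gen v) = gen v"
    using retraction_fixes star_verts[OF w] gen_parabolic by blast
  then have zy: "z \<otimes>\<^bsub>A\<^esub> y = y \<otimes>\<^bsub>A\<^esub> gen v" using zy by simp
  define q where "q = inv\<^bsub>A\<^esub> y \<otimes>\<^bsub>A\<^esub> x"
  have q: "q \<in> carrier A" using x y by (simp add: q_def)
  have yq: "y \<otimes>\<^bsub>A\<^esub> q = x" using x y by (simp add: q_def A.m_assoc[symmetric])
  have "y \<otimes>\<^bsub>A\<^esub> (q \<otimes>\<^bsub>A\<^esub> gen v) = x \<otimes>\<^bsub>A\<^esub> gen v"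
    using y q v by (simp add: A.m_assoc[symmetric] yq)
  also have "\<dots> = z \<otimes>\<^bsub>A\<^esub> (y \<otimes>\<^bsub>A\<^esub> q)" using zx yq by simp
  also have "\<dots> = (z \<otimes>\<^bsub>A\<^esub> y) \<otimes>\<^bsub>A\<^esub> q" using y q z by (simp add: A.m_assoc)
  also have "\<dots> = y \<otimes>\<^bsub>A\<^esub> (gen v \<otimes>\<^bsub>A\<^esub> q)" using zy y q v by (simp add: A.m_assoc)
  finally have "q \<otimes>\<^bsub>A\<^esub> gen v = gen v \<otimes>\<^bsub>A\<^esub> q" using y q v by simp
  then have "q \<in> parabolic (star v)" using centralizer_gen[OF v q] by blast
  moreover have "k = y \<otimes>\<^bsub>A\<^esub> (q \<otimes>\<^bsub>A\<^esub> h)"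
  proof -
    have "y \<otimes>\<^bsub>A\<^esub> (q \<otimes>\<^bsub>A\<^esub> h) = x \<otimes>\<^bsub>A\<^esub> h" using y q h by (simp add: A.m_assoc[symmetric] yq)
    also have "\<dots> = k" using h k by (simp add: x_def A.m_assoc)
    finally show ?thesis by simp
  qed
  ultimately show ?thesis using yp by blast
qed

end

section \<open>Powers as products of star words\<close>

text \<open>
  Only finitely many pairs of points are involved, so the lengths of paths between them are
  bounded, whatever the function \<open>f\<close> is.
\<close>

lemma relation_connected_bound:
  fixes R :: "'a rel"
  assumes "finite U" "\<And>x y. x \<in> U \<Longrightarrow> y \<in> U \<Longrightarrow> (x, y) \<in> R\<^sup>*"
  obtains D :: nat where
    "\<And>(f :: 'a \<Rightarrow> int) x y. (\<And>x y. (x, y) \<in> R \<Longrightarrow> \<bar>f x - f y\<bar> \<le> 1) \<Longrightarrow> x \<in> U \<Longrightarrow> y \<in> U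
      \<Longrightarrow> \<bar>f x - f y\<bar> \<le> int D"
proof -
  define d where "d = (\<lambda>(x, y). LEAST n. (x, y) \<in> R ^^ n)"
  have bound: "\<bar>f x - f y\<bar> \<le> int n" if "(x, y) \<in> R ^^ n" "\<And>x y. (x, y) \<in> R \<Longrightarrow> \<bar>f x - f y\<bar> \<le> 1"
    for f :: "'a \<Rightarrow> int" and x y n
    using that(1)
  proof (induction n arbitrary: y)
    case (Suc n)
    then obtain z where z: "(x, z) \<in> R ^^ n" "(z, y) \<in> R" by auto
    then have "\<bar>f x - f z\<bar> \<le> int n" "\<bar>f z - f y\<bar> \<le> 1" using Suc.IH that(2) by auto
    then show ?case by linarith
  qed simp
  have "\<bar>f x - f y\<bar> \<le> int (Max (d ` (U \<times> U)))"
    if f: "\<And>x y. (x, y) \<in> R \<Longrightarrow> \<bar>f x - f y\<bar> \<le> 1" and xy: "x \<in> U" "y \<in> U" for f :: "'a \<Rightarrow> int" and x y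
  proof -
    have "\<exists>n. (x, y) \<in> R ^^ n" using assms(2)[OF xy] rtrancl_imp_relpow by blast
    then have "(x, y) \<in> R ^^ d (x, y)" unfolding d_def by (auto intro: LeastI_ex)
    then have "\<bar>f x - f y\<bar> \<le> int (d (x, y))" using bound f by blast
    moreover have "d (x, y) \<le> Max (d ` (U \<times> U))" using assms(1) xy by (intro Max_ge) auto
    ultimately show ?thesis by linarith
  qed
  then show ?thesis using that by blast
qed

lemma prefix_of_power_count:
  assumes "prefix q (concat (replicate n z))" "count_list z a = 1" "count_list z b = 1"
  shows "\<bar>int (count_list q a) - int (count_list q b)\<bar> \<le> 1"
  using assms(1)
proof (induction n arbitrary: q)
  case (Suc n)
  then have "prefix q (z @ concat (replicate n z))" by simp
  then consider "prefix q z" | q' where "q = z @ q'" "prefix q' (concat (replicate n z))"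
    by (auto simp: prefix_append)
  then show ?case
  proof cases
    case 1
    then obtain r where "z = q @ r" by (auto simp: prefix_def)
    then have "count_list q a \<le> 1" "count_list q b \<le> 1"
      using assms(2,3) by auto
    then show ?thesis by linarith
  next
    case 2
    then show ?thesis using Suc.IH[of q'] assms(2,3) by simp
  qed
qed simp

lemma count_list_filter: "P a \<Longrightarrow> count_list (filter P u) a = count_list u a"
  by (induction u) auto

lemma filter_concat_replicate:
  "filter P (concat (replicate n z)) = concat (replicate n (filter P z))"
  by (simp add: filter_concat)

context pair_graph
begin

primrec star_words :: "nat \<Rightarrow> 'a word set" where
  "star_words 0 = {[]}"
| "star_words (Suc n) = {p @ u | p u v. v \<in> pverts G \<and> p \<in> words_over (star v) \<and> u \<in> star_words n}"

lemma star_words_W: "u \<in> star_words n \<Longrightarrow> u \<in> W"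
proof (induction n arbitrary: u)
  case (Suc n)
  then show ?case using words_over_mono[OF star_verts] by auto
qed simp

lemma star_words_1: "v \<in> pverts G \<Longrightarrow> p \<in> words_over (star v) \<Longrightarrow> p \<in> star_words 1"
  by auto

lemma star_words_append:
  "u \<in> star_words m \<Longrightarrow> u' \<in> star_words n \<Longrightarrow> u @ u' \<in> star_words (m + n)"
proof (induction m arbitrary: u)
  case (Suc m)
  then obtain p u1 v where u: "u = p @ u1" "v \<in> pverts G" "p \<in> words_over (star v)" "u1 \<in> star_words m"
    by auto
  then have "u1 @ u' \<in> star_words (m + n)" using Suc by blast
  then show ?case using u by auto
qed simp

lemma star_words_subseq: "u \<in> star_words n \<Longrightarrow> subseq u' u \<Longrightarrow> u' \<in> star_words n"
proof (induction n arbitrary: u u')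
  case (Suc n)
  then obtain p u1 v where u: "u = p @ u1" "v \<in> pverts G" "p \<in> words_over (star v)" "u1 \<in> star_words n"
    by auto
  then obtain p' u1' where u': "u' = p' @ u1'" "subseq p' p" "subseq u1' u1"
    using Suc.prems(2) by (auto simp: subseq_append_iff)
  have "p' \<in> words_over (star v)"
    using u(3) u'(2) by (auto simp: words_over_iff dest: list_emb_set)
  moreover have "u1' \<in> star_words n" using Suc.IH u u' by blast
  ultimately show ?case using u u' by auto
qed simp

definition pos_word :: "'a list \<Rightarrow> 'a word" where
  "pos_word xs = map (\<lambda>x. (x, False)) xs"

lemma count_pos_word: "distinct xs \<Longrightarrow> x \<in> set xs \<Longrightarrow> count_list (pos_word xs) (x, False) = 1"
  by (induction xs) (auto simp: pos_word_def count_list_0_iff)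

lemma pow_cls:
  assumes "w \<in> W"
  shows "cls w [^]\<^bsub>A\<^esub> n = cls (concat (replicate n w))" "concat (replicate n w) \<in> W"
proof -
  have "cls w [^]\<^bsub>A\<^esub> n = cls (concat (replicate n w)) \<and> concat (replicate n w) \<in> W"
  proof (induction n)
    case 0
    then show ?case by (simp add: one_A)
  next
    case (Suc n)
    have "concat (replicate n w) @ w = concat (replicate (Suc n) w)"
      by (induction n) auto
    then show ?case using Suc assms cls_mult by (metis A.nat_pow_Suc words_over_simps(3))
  qed
  then show "cls w [^]\<^bsub>A\<^esub> n = cls (concat (replicate n w))" "concat (replicate n w) \<in> W" by auto
qed

text \<open>
  Let \<open>r\<close> be the reduced form of a product of \<open>L\<close> star words that equals the \<open>n\<close>-th power. It has the
  same restrictions as that power and is still a product of \<open>L\<close> star words. Along the prefixes of \<open>r\<close> the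
  letter counts stay within a constant of each other, by connectedness of the noncommutation graph.
  Each star word misses some letter, so it can raise each count by at most twice this constant, while
  all counts finally equal \<open>n\<close>.
\<close>

lemma star_length_power_lower_bound:
  assumes xs: "distinct xs" "set xs \<subseteq> pverts G" "xs \<noteq> []"
    and conn: "\<And>x y. x \<in> set xs \<Longrightarrow> y \<in> set xs \<Longrightarrow>
      (x, y) \<in> {(x, y). x \<in> set xs \<and> y \<in> set xs \<and> (x, y) \<notin> parcs G}\<^sup>*"
    and not_star: "\<And>v. v \<in> pverts G \<Longrightarrow> \<not> set xs \<subseteq> star v"
  obtains D :: nat where "\<And>n L. cls (pos_word xs) [^]\<^bsub>A\<^esub> n \<in> cls ` star_words L \<Longrightarrow> n \<le> D * L"
proof -
  let ?R = "{(x, y). x \<in> set xs \<and> y \<in> set xs \<and> (x, y) \<notin> parcs G}"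
  let ?w = "pos_word xs"
  obtain D :: nat where D: "\<And>(f :: 'a \<Rightarrow> int) x y. (\<And>x y. (x, y) \<in> ?R \<Longrightarrow> \<bar>f x - f y\<bar> \<le> 1)
      \<Longrightarrow> x \<in> set xs \<Longrightarrow> y \<in> set xs \<Longrightarrow> \<bar>f x - f y\<bar> \<le> int D"
    using relation_connected_bound[of "set xs" ?R] conn by blast
  have w: "?w \<in> W" using xs(2) by (auto simp: pos_word_def words_over_iff)
  have "n \<le> 2 * D * L" if gn: "cls ?w [^]\<^bsub>A\<^esub> n \<in> cls ` star_words L" for n L
  proof -
    let ?wn = "concat (replicate n ?w)"
    obtain u where u: "u \<in> star_words L" "cls u = cls ?wn" using gn pow_cls[OF w] by auto
    then have "u \<approx> ?wn" using cls_eq_iff star_words_W by blast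
    then have "run u (proj []) = run ?wn (proj [])" using run_cong valid_empty by blast
    also have "run ?wn (proj []) = proj ?wn" by (rule run_positive) (auto simp: pos_word_def)
    finally have run: "run u (proj []) = proj ?wn" .
    obtain r where r: "subseq r u" "run u (proj []) = proj r"
      using reduce_word star_words_W u(1) by metis
    have rs: "r \<in> star_words L" using star_words_subseq u(1) r(1) by blast
    have proj: "proj r = proj ?wn" using run r by simp
    let ?c = "\<lambda>q x. int (count_list q (x, False))"
    have filter_r: "filter (\<lambda>s. fst s \<in> {x, y}) r = concat (replicate n (filter (\<lambda>s. fst s \<in> {x, y}) ?w))"
      if "(x, y) \<notin> parcs G" for x y
      using fun_cong[OF fun_cong[OF proj, of x], of y] that
      by (simp add: proj_def filter_concat_replicate)
    have balanced: "\<bar>?c q x - ?c q y\<bar> \<le> int D" if q: "prefix q r" and "x \<in> set xs" "y \<in> set xs" for q x y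
    proof (rule D[OF _ that(2,3)])
      fix x y assume xy: "(x, y) \<in> ?R"
      let ?f = "filter (\<lambda>s. fst s \<in> {x, y})"
      obtain r' where "r = q @ r'" using q by (auto simp: prefix_def)
      then have "prefix (?f q) (?f r)" by simp
      then have pre: "prefix (?f q) (concat (replicate n (?f ?w)))" using filter_r[of x y] xy by simp
      have "count_list (?f ?w) (x, False) = 1" "count_list (?f ?w) (y, False) = 1"
        using xy count_pos_word[OF xs(1)] by (simp_all add: count_list_filter)
      from prefix_of_power_count[OF pre this] show "\<bar>?c q x - ?c q y\<bar> \<le> 1"
        by (simp add: count_list_filter)
    qed
    have growth: "?c r x - ?c q x \<le> 2 * int D * int m"
      if "x \<in> set xs" "t \<in> star_words m" "r = q @ t" for x q t m
      using that(2,3)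
    proof (induction m arbitrary: q t)
      case (Suc m)
      then obtain p t' v where t: "t = p @ t'" "v \<in> pverts G" "p \<in> words_over (star v)" "t' \<in> star_words m"
        by auto
      have IH: "?c r x - ?c (q @ p) x \<le> 2 * int D * int m"
        using Suc.IH[OF t(4), of "q @ p"] Suc.prems(2) t(1) by simp
      \<comment> \<open>A letter missing from the star word \<open>p\<close>: its count does not change, and it controls all others.\<close>
      obtain z where z: "z \<in> set xs" "z \<notin> star v" using not_star t(2) by blast
      then have "count_list p (z, False) = 0" using t(3) by (auto simp: words_over_iff count_list_0_iff)
      then have "?c (q @ p) z = ?c q z" by simp
      moreover have "\<bar>?c (q @ p) x - ?c (q @ p) z\<bar> \<le> int D"
        by (rule balanced) (use Suc.prems(2) t(1) z that(1) in auto)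
      moreover have "\<bar>?c q x - ?c q z\<bar> \<le> int D"
        by (rule balanced) (use Suc.prems(2) z that(1) in auto)
      ultimately have "?c (q @ p) x - ?c q x \<le> 2 * int D" by linarith
      with IH show ?case by (simp add: algebra_simps)
    qed simp
    obtain x where x: "x \<in> set xs" using xs(3) by (meson last_in_set)
    have "count_list r (x, False) = count_list (filter (\<lambda>s. fst s \<in> {x, x}) r) (x, False)"
      by (simp add: count_list_filter)
    also have "\<dots> = count_list (concat (replicate n (filter (\<lambda>s. fst s \<in> {x, x}) ?w))) (x, False)"
      using filter_r[of x x] by simp
    also have "\<dots> = n"
    proof -
      have "count_list (concat (replicate n z)) a = n * count_list z a" for z :: "'a word" and a
        by (induction n) auto
      then show ?thesis using count_pos_word[OF xs(1) x] by (simp add: count_list_filter)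
    qed
    finally have "int n \<le> 2 * int D * int L" using growth[OF x rs, of "[]"] by simp
    then show ?thesis by (metis of_nat_le_iff of_nat_mult of_nat_numeral)
  qed
  then show ?thesis using that by blast
qed

section \<open>Walks in the extension graph\<close>

abbreviation E :: "'a word set pair_pre_digraph" where "E \<equiv> extension_graph G"

sublocale E: pair_bidirected_digraph E by (rule pair_bidirected_digraph_extension_graph)

abbreviation conj_by :: "'a word set \<Rightarrow> 'a word set \<Rightarrow> 'a word set" where "conj_by \<equiv> conj_act A"

lemma pverts_E: "pverts E = {conj_by (gen v) h | v h. v \<in> pverts G \<and> h \<in> carrier A}"
  by (simp add: extension_graph_def Let_def)

lemma parcs_E: "(x, y) \<in> parcs E \<longleftrightarrow>
    x \<in> pverts E \<and> y \<in> pverts E \<and> x \<noteq> y \<and> x \<otimes>\<^bsub>A\<^esub> y = y \<otimes>\<^bsub>A\<^esub> x"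
  by (simp add: extension_graph_def Let_def)

lemma commuting_conjugates_star_words:
  assumes "v \<in> pverts G" "w \<in> pverts G" "h \<in> carrier A" "k \<in> carrier A"
    and "conj_by (gen v) h \<otimes>\<^bsub>A\<^esub> conj_by (gen w) k
      = conj_by (gen w) k \<otimes>\<^bsub>A\<^esub> conj_by (gen v) h"
  shows "\<exists>c \<in> star_words 2. k = cls c \<otimes>\<^bsub>A\<^esub> h"
proof -
  obtain p q where pq: "p \<in> words_over (star w)" "q \<in> words_over (star v)"
    "k = cls p \<otimes>\<^bsub>A\<^esub> (cls q \<otimes>\<^bsub>A\<^esub> h)"
    using commuting_conjugates[OF assms] by (auto simp: parabolic_def)
  have W: "p \<in> W" "q \<in> W" using pq words_over_mono star_verts assms by blast+
  have "p @ q \<in> star_words (1 + 1)"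
    using star_words_append star_words_1 pq(1,2) assms(1,2) by blast
  then have "p @ q \<in> star_words 2" unfolding one_add_one .
  moreover have "k = cls (p @ q) \<otimes>\<^bsub>A\<^esub> h"
    using pq(3) W assms(3) cls_mult[OF W] A.m_assoc[of "cls p" "cls q" h] by simp
  ultimately show ?thesis by blast
qed

text \<open>
  Each edge of the walk contributes two star elements, by \<open>commuting_conjugates\<close>; the remaining two allow for
  the choice of the conjugator \<open>k\<close> at the last vertex.
\<close>

lemma walk_star_words:
  assumes "v \<in> pverts G" "h \<in> carrier A" "E.awalk (conj_by (gen v) h) p (conj_by (gen w) k)"
    "w \<in> pverts G" "k \<in> carrier A"
  shows "\<exists>c \<in> star_words (2 * length p + 2). k = cls c \<otimes>\<^bsub>A\<^esub> h"
  using assms(3-5)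
proof (induction p arbitrary: w k rule: rev_induct)
  case Nil
  then have "conj_by (gen v) h = conj_by (gen w) k" by (simp add: E.awalk_Nil_iff)
  then show ?case using commuting_conjugates_star_words[OF assms(1) Nil(2) assms(2) Nil(3)]
    by (simp only: list.size mult_0_right add_0)
next
  case (snoc e p)
  obtain y where y: "E.awalk (conj_by (gen v) h) p y" "(y, conj_by (gen w) k) \<in> parcs E"
    using snoc.prems(1) by (cases e) (auto simp: E.awalk_Cons_iff E.awalk_Nil_iff)
  then obtain w' k' where w': "w' \<in> pverts G" "k' \<in> carrier A" "y = conj_by (gen w') k'"
    using parcs_E pverts_E by auto
  then obtain c where c: "c \<in> star_words (2 * length p + 2)" "k' = cls c \<otimes>\<^bsub>A\<^esub> h"
    using snoc.IH y(1) by blast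
  have "y \<otimes>\<^bsub>A\<^esub> conj_by (gen w) k = conj_by (gen w) k \<otimes>\<^bsub>A\<^esub> y"
    using y(2) by (simp add: parcs_E)
  then obtain c' where c': "c' \<in> star_words 2" "k = cls c' \<otimes>\<^bsub>A\<^esub> k'"
    using commuting_conjugates_star_words[OF w'(1) snoc.prems(2) w'(2) snoc.prems(3)] w'(3) by blast
  have W: "c \<in> W" "c' \<in> W" using c(1) c'(1) star_words_W by blast+
  have "c' @ c \<in> star_words (2 * length (p @ [e]) + 2)"
    using star_words_append[OF c'(1) c(1)] by (simp del: star_words.simps)
  moreover have "k = cls (c' @ c) \<otimes>\<^bsub>A\<^esub> h"
    using c(2) c'(2) W assms(2) cls_mult[OF W(2,1)] A.m_assoc[of "cls c'" "cls c" h] by simp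
  ultimately show ?case by blast
qed

end

section \<open>Existence of asymptotic translation lengths\<close>

lemma subadditive_mult_bound:
  fixes f :: "nat \<Rightarrow> real"
  assumes sub: "\<And>m n. f (m + n) \<le> f m + f n"
  shows "f (q * m + r) \<le> real q * f m + f r"
proof (induction q)
  case (Suc q)
  have "f (Suc q * m + r) \<le> f m + f (q * m + r)" using sub[of m "q * m + r"] by (simp add: add.assoc)
  with Suc show ?case by (simp add: algebra_simps)
qed simp

text \<open>
  Fekete's lemma for nonnegative sequences: the limit is the infimum.
\<close>

lemma subadditive_div_convergent:
  fixes f :: "nat \<Rightarrow> real"
  assumes sub: "\<And>m n. f (m + n) \<le> f m + f n" and nonneg: "\<And>n. 0 \<le> f n"
  shows "convergent (\<lambda>n. f n / real n)"
proof -
  define t where "t = (INF n \<in> {1..}. f n / real n)"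
  have bdd: "bdd_below ((\<lambda>n. f n / real n) ` {1..})"
    using nonneg by (intro bdd_belowI[of _ 0]) auto
  have "(\<lambda>n. f n / real n) \<longlonglongrightarrow> t"
  proof (rule LIMSEQ_I)
    fix e :: real assume "0 < e"
    then have "t < t + e / 2" by simp
    moreover have "\<exists>m\<in>{1..}. f m / real m < s" if "t < s" for s
      using that unfolding t_def by (subst (asm) cINF_less_iff[OF _ bdd]) auto
    ultimately obtain m where m: "m \<ge> 1" "f m / real m < t + e / 2"
      by (meson atLeast_iff)
    \<comment> \<open>Bounds the contribution of the remainder of a division by \<open>m\<close>.\<close>
    define M where "M = (\<Sum>r<m. f r)"
    have M: "f r \<le> M" if "r < m" for r
      unfolding M_def using that nonneg by (intro member_le_sum) auto
    have upper: "f n / real n \<le> f m / real m + M / real n" if "n \<ge> 1" for n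
    proof -
      have "f n \<le> real (n div m) * f m + f (n mod m)"
        using subadditive_mult_bound[OF sub, of "n div m" m "n mod m"] by simp
      also have "\<dots> \<le> real (n div m) * f m + M" using M m(1) by simp
      also have "real (n div m) * f m \<le> real n / real m * f m"
        using nonneg of_nat_div_le_of_nat[of n m, where ?'a = real] by (intro mult_right_mono) auto
      finally have "f n \<le> real n * (f m / real m) + M" by simp
      then have "f n / real n \<le> (real n * (f m / real m) + M) / real n"
        by (intro divide_right_mono) auto
      also have "\<dots> = f m / real m + M / real n" using that by (simp add: add_divide_distrib)
      finally show ?thesis .
    qed
    obtain N :: nat where N: "2 * M / e < real N" using reals_Archimedean2 by blast
    have "norm (f n / real n - t) < e" if "n \<ge> max 1 N" for n
    proof -
      have "2 * M / e < real n" using N that by linarith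
      then have "M / real n < e / 2" using \<open>0 < e\<close> that by (simp add: field_simps)
      then have "f n / real n < t + e" using upper[of n] m(2) that by linarith
      moreover have "t \<le> f n / real n"
        unfolding t_def using bdd that by (intro cINF_lower) auto
      ultimately show ?thesis using \<open>0 < e\<close> by simp
    qed
    then show "\<exists>N. \<forall>n\<ge>N. norm (f n / real n - t) < e" by blast
  qed
  then show ?thesis by (auto simp: convergent_def)
qed

text \<open>
  The displacements of a point under the powers of \<open>g\<close> form a subadditive sequence, and a change of
  the point alters them by a bounded amount.
\<close>

lemma asymp_transl_length_limit:
  fixes d :: "'x \<Rightarrow> 'x \<Rightarrow> real"
  assumes "group A" and g: "g \<in> carrier A" and x: "x \<in> X"
    and nonneg: "\<And>x y. 0 \<le> d x y"
    and triangle: "\<And>x y z. x \<in> X \<Longrightarrow> y \<in> X \<Longrightarrow> z \<in> X \<Longrightarrow> d x z \<le> d x y + d y z"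
    and closed: "\<And>x g. x \<in> X \<Longrightarrow> g \<in> carrier A \<Longrightarrow> act x g \<in> X"
    and act_mult: "\<And>x g h. x \<in> X \<Longrightarrow> g \<in> carrier A \<Longrightarrow> h \<in> carrier A
      \<Longrightarrow> act x (g \<otimes>\<^bsub>A\<^esub> h) = act (act x g) h"
    and contract: "\<And>x y g. x \<in> X \<Longrightarrow> y \<in> X \<Longrightarrow> g \<in> carrier A \<Longrightarrow> d (act x g) (act y g) \<le> d x y"
  shows "(\<lambda>n. d (act x (g [^]\<^bsub>A\<^esub> (n::nat))) x / real n) \<longlonglongrightarrow> asymp_transl_length X d A act g"
proof -
  interpret A: group A by fact
  define f where "f x n = d (act x (g [^]\<^bsub>A\<^esub> (n::nat))) x" for x n
  have pow: "g [^]\<^bsub>A\<^esub> n \<in> carrier A" for n :: nat using g by simp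
  have sub: "f x (m + n) \<le> f x m + f x n" for m n
  proof -
    have "d (act x (g [^]\<^bsub>A\<^esub> (m + n))) x
        \<le> d (act (act x (g [^]\<^bsub>A\<^esub> m)) (g [^]\<^bsub>A\<^esub> n)) (act x (g [^]\<^bsub>A\<^esub> n)) + d (act x (g [^]\<^bsub>A\<^esub> n)) x"
      using triangle act_mult closed x g pow by (simp add: A.nat_pow_mult[symmetric])
    also have "\<dots> \<le> d (act x (g [^]\<^bsub>A\<^esub> m)) x + d (act x (g [^]\<^bsub>A\<^esub> n)) x"
      using contract closed x pow by simp
    finally show ?thesis by (simp add: f_def)
  qed
  obtain t where t: "(\<lambda>n. f x n / real n) \<longlonglongrightarrow> t"
    using subadditive_div_convergent[of "f x"] sub nonneg by (auto simp: f_def convergent_def)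
  have all: "(\<lambda>n. f y n / real n) \<longlonglongrightarrow> t" if y: "y \<in> X" for y
  proof -
    define C where "C = d x y + d y x"
    have close: "\<bar>f y n - f x n\<bar> \<le> C" for n
    proof -
      have *: "f y n \<le> f x n + d y x + d x y" if "x \<in> X" "y \<in> X" for x y
      proof -
        let ?h = "g [^]\<^bsub>A\<^esub> n"
        have "d (act y ?h) y \<le> d (act y ?h) (act x ?h) + d (act x ?h) y"
          using triangle closed that pow by simp
        also have "d (act x ?h) y \<le> d (act x ?h) x + d x y"
          using triangle closed that pow by simp
        also have "d (act y ?h) (act x ?h) \<le> d y x" using contract that pow by simp
        finally show ?thesis by (simp add: f_def)
      qed
      show ?thesis using *[OF x y] *[OF y x] by (simp add: C_def)
    qed
    have "(\<lambda>n. f y n / real n - f x n / real n) \<longlonglongrightarrow> 0"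
    proof (rule tendsto_0_le[where K = 1])
      show "(\<lambda>n. C / real n) \<longlonglongrightarrow> 0" by (rule lim_const_over_n)
      have "C \<ge> 0" using nonneg by (simp add: C_def)
      then show "\<forall>\<^sub>F n in sequentially. norm (f y n / real n - f x n / real n) \<le> norm (C / real n) * 1"
        using close by (intro always_eventually)
          (auto simp: diff_divide_distrib[symmetric] divide_right_mono)
    qed
    from tendsto_add[OF this t] show ?thesis by simp
  qed
  have "asymp_transl_length X d A act g = t"
    unfolding asymp_transl_length_def
  proof (rule the_equality)
    show "\<forall>x\<in>X. (\<lambda>n. d (act x (g [^]\<^bsub>A\<^esub> (n::nat))) x / real n) \<longlonglongrightarrow> t"
      using all by (simp add: f_def)
    show "s = t" if "\<forall>x\<in>X. (\<lambda>n. d (act x (g [^]\<^bsub>A\<^esub> (n::nat))) x / real n) \<longlonglongrightarrow> s" for s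
      using that x t LIMSEQ_unique by (auto simp: f_def)
  qed
  then show ?thesis using t by (simp add: f_def)
qed

section \<open>Connectedness and distances\<close>

lemma connected_closed_set:
  assumes "connected (with_proj H)" "X \<subseteq> pverts H" "X \<noteq> {}"
    and closed: "\<And>x y. x \<in> X \<Longrightarrow> (x, y) \<in> parcs H \<or> (y, x) \<in> parcs H \<Longrightarrow> y \<in> X"
  shows "X = pverts H"
proof -
  obtain x where x: "x \<in> X" using assms(3) by blast
  have "y \<in> X" if "y \<in> pverts H" for y
  proof -
    have "(x, y) \<in> rtrancl_on (verts (with_proj H)) ((arcs_ends (with_proj H))\<^sup>s)"
      using assms(1,2) x that unfolding connected_conv by auto
    then show ?thesis
    proof (induction rule: rtrancl_on_induct)
      case base
      then show ?case using x by simp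
    next
      case (step y z)
      then show ?case using closed by (auto simp: symcl_def)
    qed
  qed
  then show ?thesis using assms(2) by blast
qed

context pair_wf_digraph
begin

lemma graph_dist_le: "awalk u p v \<Longrightarrow> graph_dist G u v \<le> real (length p)"
  unfolding graph_dist_def by (auto intro: Least_le)

lemma graph_dist_walk:
  assumes "awalk u p v"
  obtains q where "awalk u q v" "graph_dist G u v = real (length q)"
proof -
  have "\<exists>q. awalk u q v \<and> length q = (LEAST n. \<exists>q. awalk u q v \<and> length q = n)"
    by (rule LeastI_ex) (use assms in blast)
  then show ?thesis using that unfolding graph_dist_def by auto
qed

lemma graph_dist_triangle:
  assumes "awalk u p v" "awalk v q w"
  shows "graph_dist G u w \<le> graph_dist G u v + graph_dist G v w"
proof -
  obtain p' q' where "awalk u p' v" "graph_dist G u v = real (length p')"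
    "awalk v q' w" "graph_dist G v w = real (length q')"
    using graph_dist_walk assms by metis
  then show ?thesis using graph_dist_le[of u "p' @ q'" w] awalk_appendI by fastforce
qed

end

context pair_graph
begin

lemma conj_by_carrier [simp]: "x \<in> carrier A \<Longrightarrow> g \<in> carrier A \<Longrightarrow> conj_by x g \<in> carrier A"
  by (simp add: conj_act_def)

lemma conj_by_mult:
  "x \<in> carrier A \<Longrightarrow> g \<in> carrier A \<Longrightarrow> h \<in> carrier A
    \<Longrightarrow> conj_by x (g \<otimes>\<^bsub>A\<^esub> h) = conj_by (conj_by x g) h"
  by (simp add: conj_act_def A.inv_mult_group A.m_assoc)

lemma conj_by_one [simp]: "x \<in> carrier A \<Longrightarrow> conj_by x \<one>\<^bsub>A\<^esub> = x"
  by (simp add: conj_act_def)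

lemma conj_by_commuting:
  assumes "x \<in> carrier A" "g \<in> carrier A" "x \<otimes>\<^bsub>A\<^esub> g = g \<otimes>\<^bsub>A\<^esub> x"
  shows "conj_by x g = x"
proof -
  have "conj_by x g = inv\<^bsub>A\<^esub> g \<otimes>\<^bsub>A\<^esub> (x \<otimes>\<^bsub>A\<^esub> g)"
    unfolding conj_act_def using assms(1,2) by (simp add: A.m_assoc)
  also have "\<dots> = (inv\<^bsub>A\<^esub> g \<otimes>\<^bsub>A\<^esub> g) \<otimes>\<^bsub>A\<^esub> x"
    unfolding assms(3) by (rule A.m_assoc[symmetric]) (use assms in auto)
  also have "\<dots> = x" using assms(1,2) by simp
  finally show ?thesis .
qed

lemma conj_by_hom:
  assumes "x \<in> carrier A" "y \<in> carrier A" "g \<in> carrier A"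
  shows "conj_by x g \<otimes>\<^bsub>A\<^esub> conj_by y g = conj_by (x \<otimes>\<^bsub>A\<^esub> y) g"
proof -
  have "g \<otimes>\<^bsub>A\<^esub> (inv\<^bsub>A\<^esub> g \<otimes>\<^bsub>A\<^esub> (y \<otimes>\<^bsub>A\<^esub> g)) = y \<otimes>\<^bsub>A\<^esub> g"
    using assms by (simp add: A.m_assoc[symmetric])
  then show ?thesis using assms by (simp add: conj_act_def A.m_assoc)
qed

lemma conj_by_inj:
  assumes "x \<in> carrier A" "y \<in> carrier A" "g \<in> carrier A" "conj_by x g = conj_by y g"
  shows "x = y"
proof -
  have "conj_by (conj_by z g) (inv\<^bsub>A\<^esub> g) = z" if "z \<in> carrier A" for z
    using that assms(3) by (simp add: conj_by_mult[symmetric])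
  then show ?thesis using assms by metis
qed

lemma pverts_E_carrier: "x \<in> pverts E \<Longrightarrow> x \<in> carrier A"
  by (auto simp: pverts_E)

lemma gen_pverts_E:
  assumes "v \<in> pverts G"
  shows "gen v \<in> pverts E"
proof -
  have "gen v = conj_by (gen v) \<one>\<^bsub>A\<^esub>" using assms by simp
  then show ?thesis unfolding pverts_E using assms A.one_closed by blast
qed

lemma conj_by_pverts_E:
  assumes "x \<in> pverts E" "g \<in> carrier A"
  shows "conj_by x g \<in> pverts E"
proof -
  obtain v h where x: "v \<in> pverts G" "h \<in> carrier A" "x = conj_by (gen v) h"
    using assms(1) by (auto simp: pverts_E)
  then have "conj_by x g = conj_by (gen v) (h \<otimes>\<^bsub>A\<^esub> g)"
    using conj_by_mult assms(2) gen_carrier by presburger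
  then show ?thesis unfolding pverts_E using x(1,2) assms(2) A.m_closed by blast
qed

lemma awalk_conj_by:
  assumes "E.awalk x p y" "g \<in> carrier A"
  shows "E.awalk (conj_by x g) (map (\<lambda>(x, y). (conj_by x g, conj_by y g)) p) (conj_by y g)"
  using assms(1)
proof (induction p arbitrary: x)
  case Nil
  then show ?case using assms(2) conj_by_pverts_E[of y g] by (auto simp: E.awalk_Nil_iff)
next
  case (Cons e p)
  then obtain z where e: "e = (x, z)" "(x, z) \<in> parcs E" "E.awalk z p y"
    by (cases e) (auto simp: E.awalk_Cons_iff)
  have "(conj_by x g, conj_by z g) \<in> parcs E"
    using e(2) assms(2) conj_by_pverts_E pverts_E_carrier conj_by_inj conj_by_hom
    unfolding parcs_E by metis
  then show ?case using Cons.IH[OF e(3)] e(1) by (simp add: E.awalk_Cons_iff)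
qed

definition joined :: "'a word set \<Rightarrow> 'a word set \<Rightarrow> bool" where
  "joined x y \<longleftrightarrow> (\<exists>p. E.awalk x p y)"

lemma joined_refl: "x \<in> pverts E \<Longrightarrow> joined x x"
  unfolding joined_def by (auto intro!: exI[of _ "[]"] simp: E.awalk_Nil_iff)

lemma joined_sym: "joined x y \<Longrightarrow> joined y x"
  unfolding joined_def using E.awalk_rev_path by blast

lemma joined_trans: "joined x y \<Longrightarrow> joined y z \<Longrightarrow> joined x z"
  unfolding joined_def using E.awalk_appendI by blast

lemma joined_conj_by: "joined x y \<Longrightarrow> g \<in> carrier A \<Longrightarrow> joined (conj_by x g) (conj_by y g)"
  unfolding joined_def using awalk_conj_by by blast

lemma adjacent_gens_walk:
  assumes "(u, v) \<in> parcs G"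
  shows "\<exists>p. E.awalk (gen u) p (gen v) \<and> length p \<le> 1"
proof -
  have v: "gen u \<in> pverts E" "gen v \<in> pverts E" using assms gen_pverts_E wellformed' by auto
  have "gen u \<otimes>\<^bsub>A\<^esub> gen v = gen v \<otimes>\<^bsub>A\<^esub> gen u"
    using assms by (rule raag_gen_commute[OF pair_graph])
  then have "gen u = gen v \<or> (gen u, gen v) \<in> parcs E" using v by (auto simp: parcs_E)
  then show ?thesis
  proof
    assume "gen u = gen v"
    then show ?thesis using v by (intro exI[of _ "[]"]) (simp add: E.awalk_Nil_iff)
  next
    assume "(gen u, gen v) \<in> parcs E"
    then show ?thesis using v by (intro exI[of _ "[(gen u, gen v)]"]) (simp add: E.awalk_Cons_iff E.awalk_Nil_iff)
  qed
qed

lemma joined_gens: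
  assumes "connected (with_proj G)" "u \<in> pverts G" "v \<in> pverts G"
  shows "joined (gen u) (gen v)"
proof -
  let ?X = "{x \<in> pverts G. joined (gen u) (gen x)}"
  have "?X = pverts G"
  proof (rule connected_closed_set[OF assms(1)])
    show "?X \<noteq> {}" using assms(2) joined_refl gen_pverts_E by blast
    fix x y assume x: "x \<in> ?X" and "(x, y) \<in> parcs G \<or> (y, x) \<in> parcs G"
    then have xy: "(x, y) \<in> parcs G" using adj_sym by blast
    then have "joined (gen x) (gen y)" unfolding joined_def using adjacent_gens_walk by blast
    then show "y \<in> ?X" using x xy joined_trans wellformed' by blast
  qed auto
  then show ?thesis using assms(3) by blast
qed

text \<open>
  By connectedness of the graph all generators are joined to each other. Conjugation by a letter at
  \<open>u\<close> fixes the generator \<open>u\<close>, so it moves a generator \<open>v\<close> to a vertex that is still joined to \<open>u\<close>.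
\<close>

lemma extension_graph_connected:
  assumes conn: "connected (with_proj G)" and "x \<in> pverts E" "y \<in> pverts E"
  shows "joined x y"
proof -
  have letter: "joined (gen v) (conj_by (gen v) (cls [s]))" if "v \<in> pverts G" "fst s \<in> pverts G" for v s
  proof -
    have s: "cls [s] \<in> carrier A" using that by simp
    have "cls [s] \<in> parabolic (star (fst s))" by (auto simp: parabolic_def star_def)
    then have "conj_by (gen (fst s)) (cls [s]) = gen (fst s)"
      using that s by (intro conj_by_commuting parabolic_star_commute) auto
    then have "joined (gen (fst s)) (conj_by (gen v) (cls [s]))"
      using joined_conj_by[OF joined_gens[OF conn that(2,1)] s] by simp
    then show ?thesis using joined_trans joined_gens[OF conn that] by blast
  qed
  have word: "joined (gen v) (conj_by (gen v) (cls u))" if "v \<in> pverts G" "u \<in> W" for v u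
    using that(2)
  proof (induction u rule: rev_induct)
    case Nil
    then show ?case using that(1) joined_refl gen_pverts_E by (simp add: one_A[symmetric])
  next
    case (snoc s u)
    have s: "fst s \<in> pverts G" "[s] \<in> W" and u: "u \<in> W" using snoc.prems by auto
    have "conj_by (gen v) (cls (u @ [s])) = conj_by (conj_by (gen v) (cls u)) (cls [s])"
      using conj_by_mult[of "gen v" "cls u" "cls [s]"] cls_mult[OF u s(2)] that(1) s u by simp
    then show ?case
      using joined_trans[OF letter[OF that(1) s(1)]] joined_conj_by[OF snoc.IH[OF u], of "cls [s]"] s
      by simp
  qed
  obtain v u w u' where x: "v \<in> pverts G" "u \<in> W" "x = conj_by (gen v) (cls u)"
    and y: "w \<in> pverts G" "u' \<in> W" "y = conj_by (gen w) (cls u')"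
    using assms(2,3) by (auto simp: pverts_E carrier_A)
  show ?thesis
    using joined_trans[OF joined_sym[OF word[OF x(1,2)]]
        joined_trans[OF joined_gens[OF conn x(1) y(1)] word[OF y(1,2)]]] x y by simp
qed

lemma ext_transl_length_limit:
  assumes conn: "connected (with_proj G)" and g: "g \<in> carrier A" and x: "x \<in> pverts E"
  shows "(\<lambda>n. graph_dist E (conj_by x (g [^]\<^bsub>A\<^esub> (n::nat))) x / real n) \<longlonglongrightarrow> ext_transl_length G g"
  unfolding ext_transl_length_def
proof (rule asymp_transl_length_limit[OF A.group_axioms g x])
  show "0 \<le> graph_dist E x y" for x y by (simp add: graph_dist_def)
  show "graph_dist E x z \<le> graph_dist E x y + graph_dist E y z"
    if xyz: "x \<in> pverts E" "y \<in> pverts E" "z \<in> pverts E" for x y z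
  proof -
    obtain p where p: "E.awalk x p y"
      using extension_graph_connected[OF conn xyz(1,2)] unfolding joined_def ..
    obtain q where q: "E.awalk y q z"
      using extension_graph_connected[OF conn xyz(2,3)] unfolding joined_def ..
    show ?thesis by (rule E.graph_dist_triangle[OF p q])
  qed
  show "conj_by x g \<in> pverts E" if "x \<in> pverts E" "g \<in> carrier A" for x g
    using that by (rule conj_by_pverts_E)
  show "conj_by x (g \<otimes>\<^bsub>A\<^esub> h) = conj_by (conj_by x g) h"
    if "x \<in> pverts E" "g \<in> carrier A" "h \<in> carrier A" for x g h
    by (rule conj_by_mult[OF pverts_E_carrier[OF that(1)] that(2,3)])
  show "graph_dist E (conj_by x g) (conj_by y g) \<le> graph_dist E x y"
    if xy: "x \<in> pverts E" "y \<in> pverts E" and g: "g \<in> carrier A" for x y g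
  proof -
    obtain p0 where "E.awalk x p0 y"
      using extension_graph_connected[OF conn xy] unfolding joined_def ..
    then obtain p where p: "E.awalk x p y" "graph_dist E x y = real (length p)"
      by (rule E.graph_dist_walk)
    then show ?thesis using E.graph_dist_le[OF awalk_conj_by[OF p(1) g]] by simp
  qed
qed

section \<open>An edge with indecomposable stars\<close>

text \<open>
  An edge for which the union of the two stars is largest has this property. If the vertices of the
  union that are not reachable from \<open>a\<close> in the complement formed a nonempty set, then the union would
  be a join, and maximality would make it closed under adjacency.
\<close>

lemma edge_with_indecomposable_stars:
  assumes conn: "connected (with_proj G)" "connected (with_proj (complement_graph G))"
    and nontrivial: "2 \<le> card (pverts G)"
  obtains a b where "(a, b) \<in> parcs G"
    "\<And>x y. x \<in> star a \<union> star b \<Longrightarrow> y \<in> star a \<union> star b \<Longrightarrow>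
      (x, y) \<in> {(x, y). x \<in> star a \<union> star b \<and> y \<in> star a \<union> star b \<and> (x, y) \<notin> parcs G}\<^sup>*"
proof -
  have fin: "finite (pverts G)" by (rule pair_finite_verts)
  have "parcs G \<noteq> {}"
  proof
    assume "parcs G = {}"
    moreover obtain v where "v \<in> pverts G" using nontrivial by fastforce
    ultimately have "{v} = pverts G" by (intro connected_closed_set[OF conn(1)]) auto
    then have "card (pverts G) = 1" by (metis is_singletonI is_singleton_altdef)
    then show False using nontrivial by simp
  qed
  then have "Max ((\<lambda>e. card (star (fst e) \<union> star (snd e))) ` parcs G)
      \<in> (\<lambda>e. card (star (fst e) \<union> star (snd e))) ` parcs G" (is "Max ?C \<in> ?C")
    using pair_finite_arcs by (intro Max_in) auto
  then obtain e where e: "e \<in> parcs G" "card (star (fst e) \<union> star (snd e)) = Max ?C" by auto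
  have greatest: "card (star p \<union> star q) \<le> card (star (fst e) \<union> star (snd e))" if "(p, q) \<in> parcs G" for p q
    unfolding e(2) using that pair_finite_arcs by (intro Max_ge) force+
  obtain a b where ab: "e = (a, b)" "(a, b) \<in> parcs G" using e(1) by (cases e) auto
  have V: "a \<in> pverts G" "b \<in> pverts G" using ab(2) wellformed' by auto
  define U where "U = star a \<union> star b"
  define R where "R = {(x, y). x \<in> U \<and> y \<in> U \<and> (x, y) \<notin> parcs G}"
  have UV: "U \<subseteq> pverts G" using V star_verts by (auto simp: U_def)
  have aU: "a \<in> U" by (simp add: U_def star_def)
  have symR: "sym R" using adj_sym by (auto simp: R_def sym_def)
  have all: "(a, y) \<in> R\<^sup>*" if "y \<in> U" for y
  proof (rule ccontr)
    assume ny: "(a, y) \<notin> R\<^sup>*"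
    define X where "X = {x \<in> U. (a, x) \<in> R\<^sup>*}"
    define Y where "Y = {x \<in> U. (a, x) \<notin> R\<^sup>*}"
    have XY: "a \<in> X" "y \<in> Y" "X \<union> Y = U" using aU ny that by (auto simp: X_def Y_def)
    have join: "(p, q) \<in> parcs G" if "p \<in> X" "q \<in> Y" for p q
    proof (rule ccontr)
      assume "(p, q) \<notin> parcs G"
      then have "(p, q) \<in> R" using that by (simp add: R_def X_def Y_def)
      moreover have "(a, p) \<in> R\<^sup>*" "(a, q) \<notin> R\<^sup>*" using that by (simp_all add: X_def Y_def)
      ultimately show False by (blast intro: rtrancl_into_rtrancl)
    qed
    have star_U: "star p \<union> star q = U" if pq: "p \<in> X" "q \<in> Y" for p q
    proof -
      have "U \<subseteq> star p \<union> star q" using XY(3) join pq adj_sym by (auto simp: star_def)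
      moreover have "card (star p \<union> star q) \<le> card U"
        using greatest[OF join[OF pq]] ab(1) by (simp add: U_def)
      moreover have "finite (star p \<union> star q)"
      proof -
        have "p \<in> pverts G" "q \<in> pverts G" using pq UV XY(3) by blast+
        then show ?thesis using star_verts fin finite_subset[of _ "pverts G"] by blast
      qed
      ultimately show ?thesis by (metis card_seteq)
    qed
    have "U = pverts G"
    proof (rule connected_closed_set[OF conn(1) UV])
      show "U \<noteq> {}" using aU by blast
      fix p q assume p: "p \<in> U" and "(p, q) \<in> parcs G \<or> (q, p) \<in> parcs G"
      then have "q \<in> star p" using adj_sym by (auto simp: star_def)
      then show "q \<in> U" using p XY star_U by blast
    qed
    have "X = pverts (complement_graph G)"
    proof (rule connected_closed_set[OF conn(2)])
      show "X \<subseteq> pverts (complement_graph G)" using UV by (auto simp: complement_graph_def X_def)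
      show "X \<noteq> {}" using XY by blast
      fix p q assume p: "p \<in> X" and "(p, q) \<in> parcs (complement_graph G) \<or> (q, p) \<in> parcs (complement_graph G)"
      then have "q \<in> U" "(p, q) \<notin> parcs G"
        using \<open>U = pverts G\<close> adj_sym by (auto simp: complement_graph_def)
      then show "q \<in> X" using p join XY(3) by blast
    qed
    then have "X = U" using \<open>U = pverts G\<close> by (simp add: complement_graph_def)
    then show False using XY by (auto simp: X_def Y_def)
  qed
  have "(x, y) \<in> R\<^sup>*" if "x \<in> U" "y \<in> U" for x y
    using all[OF that(1)] all[OF that(2)] symR by (meson rtrancl_trans sym_rtrancl symD)
  then show ?thesis using that ab(2) unfolding R_def U_def by blast
qed

text \<open>
  A vertex \<open>v\<close> whose star contains the union would itself belong to it, and would be isolated in the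
  complement graph on the union.
\<close>

lemma edge_stars_not_in_star:
  assumes ab: "(a, b) \<in> parcs G" and v: "v \<in> pverts G"
    and conn: "\<And>x y. x \<in> star a \<union> star b \<Longrightarrow> y \<in> star a \<union> star b \<Longrightarrow>
      (x, y) \<in> {(x, y). x \<in> star a \<union> star b \<and> y \<in> star a \<union> star b \<and> (x, y) \<notin> parcs G}\<^sup>*"
  shows "\<not> star a \<union> star b \<subseteq> star v"
proof
  let ?R = "{(x, y). x \<in> star a \<union> star b \<and> y \<in> star a \<union> star b \<and> (x, y) \<notin> parcs G}"
  assume sub: "star a \<union> star b \<subseteq> star v"
  have "a \<in> star v" using sub by (auto simp: star_def)
  then have vU: "v \<in> star a \<union> star b" using adj_sym by (auto simp: star_def)
  have "y = v" if "(v, y) \<in> ?R\<^sup>*" for y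
    using that
  proof (induction rule: rtrancl_induct)
    case (step y z)
    then have "z \<in> star v" "(v, z) \<notin> parcs G" using sub by auto
    then show ?case by (simp add: star_def)
  qed simp
  then have "a = v" "b = v" using conn[OF vU] by (auto simp: star_def)
  then show False using ab by simp
qed

section \<open>An element of small translation length\<close>

text \<open>
  The element is the product of the star of \<open>a\<close> followed by the rest of the star of \<open>b\<close>, for an edge
  \<open>ab\<close> with indecomposable stars. Its first factor fixes \<open>a\<close> and its second factor fixes \<open>b\<close>.
\<close>

theorem exists_small_translation:
  assumes conn: "connected (with_proj G)" "connected (with_proj (complement_graph G))"
    and nontrivial: "2 \<le> card (pverts G)"
  obtains g where "g \<in> carrier A" "0 < ext_transl_length G g" "ext_transl_length G g \<le> 2"
proof -
  obtain a b where ab: "(a, b) \<in> parcs G"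
    and Rconn: "\<And>x y. x \<in> star a \<union> star b \<Longrightarrow> y \<in> star a \<union> star b \<Longrightarrow>
      (x, y) \<in> {(x, y). x \<in> star a \<union> star b \<and> y \<in> star a \<union> star b \<and> (x, y) \<notin> parcs G}\<^sup>*"
    using edge_with_indecomposable_stars[OF assms] by blast
  have V: "a \<in> pverts G" "b \<in> pverts G" using ab wellformed' by auto
  have fin: "finite (star a)" "finite (star b - star a)"
    using star_verts V pair_finite_verts finite_subset by blast+
  obtain xs where xs: "set xs = star a" "distinct xs" using finite_distinct_list[OF fin(1)] by blast
  obtain ys where ys: "set ys = star b - star a" "distinct ys" using finite_distinct_list[OF fin(2)] by blast
  let ?w = "pos_word (xs @ ys)"
  have set: "set (xs @ ys) = star a \<union> star b" using xs ys by auto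
  have verts: "set (xs @ ys) \<subseteq> pverts G" unfolding set using star_verts V by blast
  have W: "pos_word xs \<in> W" "pos_word ys \<in> W" using verts by (auto simp: pos_word_def words_over_iff)
  define g where "g = cls ?w"
  have g_mult: "g = cls (pos_word xs) \<otimes>\<^bsub>A\<^esub> cls (pos_word ys)"
    using cls_mult[OF W] by (simp add: g_def pos_word_def)
  have g: "g \<in> carrier A" using W by (simp add: g_mult)
  have star_xs: "cls (pos_word xs) \<in> parabolic (star a)" and star_ys: "cls (pos_word ys) \<in> parabolic (star b)"
    using xs ys by (auto simp: parabolic_def pos_word_def words_over_iff)
  let ?f = "\<lambda>n::nat. graph_dist E (conj_by (gen a) (g [^]\<^bsub>A\<^esub> n)) (gen a)"
  have aE: "gen a \<in> pverts E" "gen b \<in> pverts E" using V gen_pverts_E by auto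
  have limit: "(\<lambda>n. ?f n / real n) \<longlonglongrightarrow> ext_transl_length G g"
    by (rule ext_transl_length_limit[OF conn(1) g aE(1)])
  have step: "\<exists>p. E.awalk (conj_by (gen a) g) p (gen a) \<and> length p \<le> 2"
  proof -
    have "conj_by (gen a) (cls (pos_word xs)) = gen a"
      using V W parabolic_star_commute[OF V(1) star_xs] by (intro conj_by_commuting) auto
    then have ga: "conj_by (gen a) g = conj_by (gen a) (cls (pos_word ys))"
      unfolding g_mult using V W by (simp add: conj_by_mult)
    have gb: "conj_by (gen b) (cls (pos_word ys)) = gen b"
      using V W parabolic_star_commute[OF V(2) star_ys] by (intro conj_by_commuting) auto
    obtain p where p: "E.awalk (gen a) p (gen b)" "length p \<le> 1" using adjacent_gens_walk[OF ab] by blast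
    obtain q where q: "E.awalk (gen b) q (gen a)" "length q \<le> 1"
      using adjacent_gens_walk ab adj_sym by blast
    from awalk_conj_by[OF p(1), of "cls (pos_word ys)"] obtain p' where
      p': "E.awalk (conj_by (gen a) g) p' (gen b)" "length p' \<le> 1"
      using p(2) W gb ga by fastforce
    then have "E.awalk (conj_by (gen a) g) (p' @ q) (gen a)" using q(1) E.awalk_appendI by blast
    moreover have "length (p' @ q) \<le> 2" using p'(2) q(2) by simp
    ultimately show ?thesis by blast
  qed
  have upper_walk: "\<exists>p. E.awalk (conj_by (gen a) (g [^]\<^bsub>A\<^esub> n)) p (gen a) \<and> length p \<le> 2 * n" for n :: nat
  proof (induction n)
    case 0
    then show ?case using aE V by (intro exI[of _ "[]"]) (simp add: E.awalk_Nil_iff)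
  next
    case (Suc n)
    then obtain p where p: "E.awalk (conj_by (gen a) (g [^]\<^bsub>A\<^esub> n)) p (gen a)" "length p \<le> 2 * n" by blast
    have "conj_by (conj_by (gen a) (g [^]\<^bsub>A\<^esub> n)) g = conj_by (gen a) (g [^]\<^bsub>A\<^esub> Suc n)"
      using V g by (simp add: conj_by_mult)
    from awalk_conj_by[OF p(1) g, unfolded this]
    obtain p' where p': "E.awalk (conj_by (gen a) (g [^]\<^bsub>A\<^esub> Suc n)) p' (conj_by (gen a) g)"
      and "length p' = length p" by (metis length_map)
    then have len: "length p' \<le> 2 * n" using p(2) by simp
    obtain q where q: "E.awalk (conj_by (gen a) g) q (gen a)" "length q \<le> 2" using step by blast
    have "E.awalk (conj_by (gen a) (g [^]\<^bsub>A\<^esub> Suc n)) (p' @ q) (gen a)"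
      by (rule E.awalk_appendI[OF p' q(1)])
    moreover have "length (p' @ q) \<le> 2 * Suc n" using len q(2) by simp
    ultimately show ?case by blast
  qed
  have "?f n / real n \<le> 2" if "n \<ge> 1" for n
  proof -
    obtain p where p: "E.awalk (conj_by (gen a) (g [^]\<^bsub>A\<^esub> n)) p (gen a)" "length p \<le> 2 * n"
      using upper_walk by blast
    have "?f n \<le> real (length p)" by (rule E.graph_dist_le[OF p(1)])
    also have "\<dots> \<le> 2 * real n" using p(2) by linarith
    finally show ?thesis using that by (simp add: divide_le_eq)
  qed
  then have upper: "ext_transl_length G g \<le> 2" by (intro Lim_bounded[OF limit]) auto
  obtain D :: nat where D: "\<And>n L. cls ?w [^]\<^bsub>A\<^esub> n \<in> cls ` star_words L \<Longrightarrow> n \<le> D * L"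
  proof (rule star_length_power_lower_bound[of "xs @ ys"])
    show "distinct (xs @ ys)" using xs ys by auto
    show "set (xs @ ys) \<subseteq> pverts G" by (rule verts)
    show "xs @ ys \<noteq> []" using xs(1) by (auto simp: star_def)
    show "(x, y) \<in> {(x, y). x \<in> set (xs @ ys) \<and> y \<in> set (xs @ ys) \<and> (x, y) \<notin> parcs G}\<^sup>*"
      if "x \<in> set (xs @ ys)" "y \<in> set (xs @ ys)" for x y
      using Rconn that unfolding set by blast
    show "\<not> set (xs @ ys) \<subseteq> star v" if "v \<in> pverts G" for v
      unfolding set by (rule edge_stars_not_in_star[OF ab that Rconn])
  qed blast
  have lower: "real n \<le> real D * (2 * ?f n + 2)" for n
  proof -
    obtain p where p: "E.awalk (conj_by (gen a) (g [^]\<^bsub>A\<^esub> n)) p (gen a)" "?f n = real (length p)"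
      using upper_walk[of n] E.graph_dist_walk by blast
    have "E.awalk (conj_by (gen a) \<one>\<^bsub>A\<^esub>) (rev_path p) (conj_by (gen a) (g [^]\<^bsub>A\<^esub> n))"
      using p(1) V by simp
    from walk_star_words[OF V(1) A.one_closed this V(1)]
    obtain c where c: "c \<in> star_words (2 * length (rev_path p) + 2)" "g [^]\<^bsub>A\<^esub> n = cls c \<otimes>\<^bsub>A\<^esub> \<one>\<^bsub>A\<^esub>"
      using g by blast
    have "g [^]\<^bsub>A\<^esub> n = cls c" using c(2) star_words_W[OF c(1)] by simp
    moreover have "length (rev_path p) = length p" by (induction p) auto
    ultimately have "cls ?w [^]\<^bsub>A\<^esub> n \<in> cls ` star_words (2 * length p + 2)"
      using imageI[OF c(1), of cls] by (simp only: g_def)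
    then have "n \<le> D * (2 * length p + 2)" by (rule D)
    then have "real n \<le> real (D * (2 * length p + 2))" by (simp only: of_nat_le_iff)
    also have "\<dots> = real D * (2 * ?f n + 2)" unfolding p(2) by (simp add: algebra_simps)
    finally show ?thesis .
  qed
  have "D \<noteq> 0" using lower[of 1] by (intro notI) simp
  have "1 / (2 * real D) - 1 / real n \<le> ?f n / real n" if "n \<ge> 1" for n
  proof -
    have "real n / (2 * real D) \<le> ?f n + 1"
      using lower[of n] \<open>D \<noteq> 0\<close> by (simp add: divide_le_eq algebra_simps)
    then have "real n / (2 * real D) / real n \<le> (?f n + 1) / real n"
      by (rule divide_right_mono) simp
    then show ?thesis using that by (simp add: add_divide_distrib)
  qed
  moreover have "(\<lambda>n. 1 / (2 * real D) - 1 / real n) \<longlonglongrightarrow> 1 / (2 * real D) - 0"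
    by (intro tendsto_diff tendsto_const lim_const_over_n)
  ultimately have "1 / (2 * real D) - 0 \<le> ext_transl_length G g"
    by (intro LIMSEQ_le[OF _ limit]) auto
  moreover have "0 < 1 / (2 * real D)" using \<open>D \<noteq> 0\<close> by simp
  ultimately have "0 < ext_transl_length G g" by linarith
  then show ?thesis using that g upper by blast
qed

end

theorem theoremA:
  fixes \<Gamma> :: "'a pair_pre_digraph"
  assumes "pair_graph \<Gamma>"
    and "nontrivial_graph \<Gamma>"
    and "biconnected \<Gamma>"
  shows "(\<exists>g \<in> carrier (raag \<Gamma>). 0 < ext_transl_length \<Gamma> g \<and> ext_transl_length \<Gamma> g \<le> 2)
    \<and> ext_min_transl_length \<Gamma> \<le> 2"
proof -
  interpret pair_graph \<Gamma> by fact
  obtain g where g: "g \<in> carrier (raag \<Gamma>)" "0 < ext_transl_length \<Gamma> g" "ext_transl_length \<Gamma> g \<le> 2"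
    using exists_small_translation assms(2,3) unfolding nontrivial_graph_def biconnected_def by blast
  let ?T = "{ext_transl_length \<Gamma> g | g. g \<in> carrier (raag \<Gamma>) \<and> ext_transl_length \<Gamma> g > 0}"
  have "Inf ?T \<le> ext_transl_length \<Gamma> g"
    using g by (intro cInf_lower bdd_belowI[of _ 0]) auto
  then have "ext_min_transl_length \<Gamma> \<le> 2"
    using g(3) by (simp add: ext_min_transl_length_def min_asymp_transl_length_def ext_transl_length_def)
  then show ?thesis using g by blast
qed

end
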